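(* Suppose the kernel conditions (K1)–(K2) and the distributional conditions (D1)–(D3) of the context hold with $\alpha(p)=O(1)$, and that there are positive constants $L_1,U_1<\infty$ not depending on $p$ such that $$L_1p\le\max\big\{|\Delta|^2,\ \big|\mathbb{E}|\tilde X_1|^2-\mathbb{E}|\tilde Y_1|^2\big|\big\}\le U_1p .$$ Assume that for any $k=k^{(p)}$ in a sequence of $\mathcal{C}$, $\mathbb{E}[k^4(Z_1,Z_2)]<\infty$, and that $n/N=\rho+O(1/N)$ as $n,m\to\infty$ for some $0<\rho<1$, where $N=n+m$. If there exists a positive constant $L^*<\infty$ such that $$\big|2f(A_0^{XY})-f(A_0^X)-f(A_0^Y)\big|\ge L^*|f(A_0^{XY})|,$$ where $f=f^{(p)}$, then for any $C>0$, $\mathbb{P}(T_{n,m,p}^k>C)\to1$ as $n,m,p\to\infty$.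
   Context: Kernel: a kernel on $\mathbb{R}^p$ is a symmetric function $k:\mathbb{R}^p\times\mathbb{R}^p\to\mathbb{R}$ satisfying either (a) $k\ge0$, $k(x,y)=0$ iff $x=y$, and for all Borel probability measures $P\ne Q$ with $\int k(z,z_0)\,dP(z)<\infty$ and $\int k(z,z_0)\,dQ(z)<\infty$ for some $z_0$, one has $\int k\,d([P-Q]\times[P-Q])<0$; or (b) $-k$ is the reproducing kernel of an RKHS on $\mathbb{R}^p$ and is characteristic (the mean embedding map on Borel probability measures is injective). $\mathcal{C}$ is a set of sequences $(k^{(p)})_{p\ge1}$ of kernels, $k^{(p)}$ on $\mathbb{R}^p$. Write $a_0^k=k(x,x)$ (constant in $x$ here). Sampling: for each $p$, $X=(x_1,\dots,x_p)^\top$, $Y=(y_1,\dots,y_p)^\top$ are random vectors in $\mathbb{R}^p$; $X_1,\dots,X_n$ are i.i.d. copies of $X$, $Y_1,\dots,Y_m$ i.i.d. copies of $Y$, the two samples independent. $Z$ equals $X$ with probability $\rho$ and $Y$ with probability $1-\rho$; $Z_1,Z_2,\dots$ are i.i.d. copies of $Z$. $\tilde X=X-\mathbb{E}X$, $\tilde Y=Y-\mathbb{E}Y$, $\Delta=\mathbb{E}X-\mathbb{E}Y$, $|\cdot|$ is the Euclidean norm. $A=\mathbb{E}|Z_1-Z_2|^2$, $A^X=\mathbb{E}|X_1-X_2|^2$, $A^{XY}=\mathbb{E}|X_1-Y_1|^2$, $A^Y=\mathbb{E}|Y_1-Y_2|^2$; $A_0,A_0^X,A_0^{XY},A_0^Y$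 are their square roots. Kernel conditions: each $k^{(p)}$ occurring in $\mathcal{C}$ has the form $k^{(p)}(x,y)=f^{(p)}(|x-y|)$; $D$ is the domain of $f^{(p)}$, $D_0\subseteq D$ contains $A_0$ and $A_0^{XY}$; $f_i^{(p)}$ is the $i$-th derivative ($f_0^{(p)}=f^{(p)}$). (K1) For each $f^{(p)}$, all $s\in D$, $s_0\in D_0$: $f^{(p)}(s)=\sum_{i=0}^6\frac{1}{i!}f_i^{(p)}(s_0)(s-s_0)^i+\frac1{7!}f_7^{(p)}(\xi)(s-s_0)^7$ for some $\xi=\xi(s,s_0)$ between $s$ and $s_0$. (K2) There is $\tilde M<\infty$ such that for any $f^{(p)}$ and $s_0\in D_0$: $\max_{1\le i\le7}\sup_{s\in D}|f_i^{(p)}(s)|\cdot|s_0^i|\le\tilde M|f_0^{(p)}(s_0)|$. Distributional conditions (constants not depending on $p$): (D1) There is an integer $1\le\alpha(p)$ with $\alpha(p)=o(p)$ such that for any $1\le j\le p-\alpha(p)-1$ and $\ell>\alpha(p)$, $\{x_i\}_{i\le j}$ is independent of $\{x_i\}_{i\ge j+\ell}$ and $\{y_i\}_{i\le j}$ is independent of $\{y_i\}_{i\ge j+\ell}$. (D2) There is $0<U^*<\infty$ with $\max_{1\le j\le p}\max_{1\le r\le128}\{\mathbb{E}|x_j|^r,\mathbb{E}|y_j|^r\}<U^*$. (D3) There are $0<L_0,U_0<\infty$ with $L_0p\le\min\{A^X,A^{XY},A^Y\}\le\max\{A^X,A^{XY},A^Y\}\le U_0p$. Test statistic: $\mathcal{E}_{n,m}^k(X,Y)=\frac{2}{nm}\sum_{i=1}^n\sum_{j=1}^m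 k(X_i,Y_j)-\binom n2^{-1}\sum_{1\le i<j\le n}k(X_i,X_j)-\binom m2^{-1}\sum_{1\le i<j\le m}k(Y_i,Y_j)$; $c_{n,m}=\frac{2}{n(n-1)}+\frac{4}{nm}+\frac{2}{m(m-1)}$. Let $W_1,\dots,W_N$ be the pooled sample ($W_s=X_s$ for $s\le n$, $W_s=Y_{s-n}$ for $s>n$), $a_{s,t}=k(W_s,W_t)$ for $1\le s,t\le N$, $\tilde a_{\cdot t}=\frac{1}{N-2}\sum_{i=1}^N a_{i,t}$, $\tilde a_{s\cdot}=\frac1{N-2}\sum_{j=1}^Na_{s,j}$, $\tilde a_{\cdot\cdot}=\frac{1}{(N-1)(N-2)}\sum_{i,j=1}^Na_{i,j}$, $A^*_{s,t}=a_{s,t}-\tilde a_{\cdot t}-\tilde a_{s\cdot}+\tilde a_{\cdot\cdot}$, and $\mathcal{V}_{n,m}^{k*}(X,Y)=\frac{1}{N(N-3)}\sum_{s\ne t}(A^*_{s,t})^2-\frac{(a_0^k)^2}{(N-1)(N-3)}$. Finally $T_{n,m,p}^k=\mathcal{E}_{n,m}^k(X,Y)\big/\sqrt{c_{n,m}\mathcal{V}_{n,m}^{k*}(X,Y)}$. *)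

theory Defs
  imports "HOL-Probability.Probability" "HOL-Library.Landau_Symbols"
begin

(* The dimension p is a term, so a vector of R^p is a function nat => real that is
   extensional on {1..p}; coordinates and sample points are counted from 1. *)

type_synonym vec = "nat \<Rightarrow> real"
type_synonym kern = "vec \<Rightarrow> vec \<Rightarrow> real"

definition Rp :: "nat \<Rightarrow> vec measure" where
  "Rp p = (\<Pi>\<^sub>M i\<in>{1..p}. borel)"

definition vdist :: "nat \<Rightarrow> vec \<Rightarrow> vec \<Rightarrow> real" where
  "vdist p x y = L2_set (\<lambda>i. x i - y i) {1..p}"

definition borel_prob :: "nat \<Rightarrow> vec measure \<Rightarrow> bool" where
  "borel_prob p P \<longleftrightarrow> prob_space P \<and> sets P = sets (Rp p)"

definition kint :: "kern \<Rightarrow> vec measure \<Rightarrow> vec measure \<Rightarrow> real" where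
  "kint k P Q = (LINT z|(P \<Otimes>\<^sub>M Q). k (fst z) (snd z))"

(* The last inequality is the expansion of the integral of k with respect to the
   product of the signed measure P - Q with itself. *)
definition strong_negative_type :: "nat \<Rightarrow> kern \<Rightarrow> bool" where
  "strong_negative_type p k \<longleftrightarrow>
     (\<forall>x\<in>space (Rp p). \<forall>y\<in>space (Rp p). 0 \<le> k x y \<and> (k x y = 0 \<longleftrightarrow> x = y)) \<and>
     (\<forall>P Q. borel_prob p P \<longrightarrow> borel_prob p Q \<longrightarrow> P \<noteq> Q \<longrightarrow>
        (\<exists>z\<^sub>0\<in>space (Rp p). integrable P (\<lambda>z. k z z\<^sub>0) \<and> integrable Q (\<lambda>z. k z z\<^sub>0)) \<longrightarrow>
        kint k P P - kint k P Q - kint k Q P + kint k Q Q < 0)"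

(* The carrier of a Hilbert space of functions on S: a subset of the extensional
   functions on S, with pointwise operations and inner product ip. *)
definition hilbert_function_space ::
    "'b set \<Rightarrow> ('b \<Rightarrow> real) set \<Rightarrow> (('b \<Rightarrow> real) \<Rightarrow> ('b \<Rightarrow> real) \<Rightarrow> real) \<Rightarrow> bool" where
  "hilbert_function_space S H ip \<longleftrightarrow>
     H \<subseteq> extensional S \<and>
     (\<lambda>x\<in>S. 0) \<in> H \<and>
     (\<forall>g\<in>H. \<forall>h\<in>H. (\<lambda>x\<in>S. g x + h x) \<in> H) \<and>
     (\<forall>c. \<forall>g\<in>H. (\<lambda>x\<in>S. c * g x) \<in> H) \<and>
     (\<forall>g\<in>H. \<forall>h\<in>H. ip g h = ip h g) \<and>
     (\<forall>g\<in>H. \<forall>h\<in>H. \<forall>u\<in>H. ip (\<lambda>x\<in>S. g x + h x) u = ip g u + ip h u) \<and>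
     (\<forall>c. \<forall>g\<in>H. \<forall>u\<in>H. ip (\<lambda>x\<in>S. c * g x) u = c * ip g u) \<and>
     (\<forall>g\<in>H. 0 \<le> ip g g \<and> (ip g g = 0 \<longleftrightarrow> g = (\<lambda>x\<in>S. 0))) \<and>
     Metric_space.mcomplete H
       (\<lambda>g h. sqrt (ip (\<lambda>x\<in>S. g x - h x) (\<lambda>x\<in>S. g x - h x)))"

definition rkhs ::
    "'b set \<Rightarrow> ('b \<Rightarrow> real) set \<Rightarrow> (('b \<Rightarrow> real) \<Rightarrow> ('b \<Rightarrow> real) \<Rightarrow> real) \<Rightarrow>
     ('b \<Rightarrow> 'b \<Rightarrow> real) \<Rightarrow> bool" where
  "rkhs S H ip K \<longleftrightarrow> hilbert_function_space S H ip \<and>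
     (\<forall>x\<in>S. (\<lambda>y\<in>S. K y x) \<in> H \<and> (\<forall>g\<in>H. ip g (\<lambda>y\<in>S. K y x) = g x))"

definition is_mean_embedding ::
    "('b \<Rightarrow> real) set \<Rightarrow> (('b \<Rightarrow> real) \<Rightarrow> ('b \<Rightarrow> real) \<Rightarrow> real) \<Rightarrow> 'b measure \<Rightarrow>
     ('b \<Rightarrow> real) \<Rightarrow> bool" where
  "is_mean_embedding H ip P h \<longleftrightarrow>
     h \<in> H \<and> (\<forall>g\<in>H. integrable P g \<and> ip g h = (LINT z|P. g z))"

definition characteristic_reproducing_kernel :: "nat \<Rightarrow> kern \<Rightarrow> bool" where
  "characteristic_reproducing_kernel p K \<longleftrightarrow>
     (\<exists>H ip. rkhs (space (Rp p)) H ip K \<and>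
        (\<forall>P Q h. borel_prob p P \<longrightarrow> borel_prob p Q \<longrightarrow>
           is_mean_embedding H ip P h \<longrightarrow> is_mean_embedding H ip Q h \<longrightarrow> P = Q))"

definition kernel_on :: "nat \<Rightarrow> kern \<Rightarrow> bool" where
  "kernel_on p k \<longleftrightarrow>
     case_prod k \<in> borel_measurable (Rp p \<Otimes>\<^sub>M Rp p) \<and>
     (\<forall>x\<in>space (Rp p). \<forall>y\<in>space (Rp p). k x y = k y x) \<and>
     (strong_negative_type p k \<or> characteristic_reproducing_kernel p (\<lambda>x y. - k x y))"

(* fd i plays the role of the i-th derivative of fd 0 on D; at an endpoint of D
   (such as 0 for the half-line) the derivative is one-sided. *)
definition derivative_family :: "(nat \<Rightarrow> real \<Rightarrow> real) \<Rightarrow> real set \<Rightarrow> bool" where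
  "derivative_family fd D \<longleftrightarrow>
     (\<forall>i<7. \<forall>s\<in>D. (fd i has_real_derivative fd (Suc i) s) (at s within D))"

definition cond_K1 :: "(nat \<Rightarrow> real \<Rightarrow> real) \<Rightarrow> real set \<Rightarrow> real set \<Rightarrow> bool" where
  "cond_K1 fd D D0 \<longleftrightarrow>
     (\<forall>s\<in>D. \<forall>s\<^sub>0\<in>D0. \<exists>\<xi>\<in>D \<inter> closed_segment s s\<^sub>0.
        fd 0 s = (\<Sum>i\<le>6. fd i s\<^sub>0 / fact i * (s - s\<^sub>0) ^ i) + fd 7 \<xi> / fact 7 * (s - s\<^sub>0) ^ 7)"

definition cond_K2 :: "(nat \<Rightarrow> real \<Rightarrow> real) \<Rightarrow> real set \<Rightarrow> real set \<Rightarrow> real \<Rightarrow> bool" where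
  "cond_K2 fd D D0 B \<longleftrightarrow>
     (\<forall>s\<^sub>0\<in>D0. \<forall>i\<in>{1..7}. \<forall>s\<in>D. \<bar>fd i s\<bar> * \<bar>s\<^sub>0 ^ i\<bar> \<le> B * \<bar>fd 0 s\<^sub>0\<bar>)"

(* P, Q are the laws of the random vectors X, Y. *)

definition mean_vec :: "vec measure \<Rightarrow> vec" where
  "mean_vec P i = (LINT x|P. x i)"

definition mean_diff_norm :: "nat \<Rightarrow> vec measure \<Rightarrow> vec measure \<Rightarrow> real" where
  "mean_diff_norm p P Q = vdist p (mean_vec P) (mean_vec Q)"

definition centred_second_moment :: "nat \<Rightarrow> vec measure \<Rightarrow> real" where
  "centred_second_moment p P = (LINT x|P. (vdist p x (mean_vec P))\<^sup>2)"

definition mixture :: "real \<Rightarrow> vec measure \<Rightarrow> vec measure \<Rightarrow> vec measure" where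
  "mixture \<rho> P Q = measure_pmf (bernoulli_pmf \<rho>) \<bind> (\<lambda>b. if b then P else Q)"

definition mean_sq_dist :: "nat \<Rightarrow> vec measure \<Rightarrow> vec measure \<Rightarrow> real" where
  "mean_sq_dist p P Q = (LINT z|(P \<Otimes>\<^sub>M Q). (vdist p (fst z) (snd z))\<^sup>2)"

definition A0 :: "nat \<Rightarrow> vec measure \<Rightarrow> vec measure \<Rightarrow> real" where
  "A0 p P Q = sqrt (mean_sq_dist p P Q)"

definition m_dependent :: "nat \<Rightarrow> vec measure \<Rightarrow> nat \<Rightarrow> bool" where
  "m_dependent p P a \<longleftrightarrow>
     (\<forall>j l. 1 \<le> j \<longrightarrow> j + a + 1 \<le> p \<longrightarrow> a < l \<longrightarrow>
        prob_space.indep_var P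
          (\<Pi>\<^sub>M i\<in>{1..j}. borel) (\<lambda>x. restrict x {1..j})
          (\<Pi>\<^sub>M i\<in>{j+l..p}. borel) (\<lambda>x. restrict x {j+l..p}))"

definition cond_D1 ::
    "(nat \<Rightarrow> vec measure) \<Rightarrow> (nat \<Rightarrow> vec measure) \<Rightarrow> (nat \<Rightarrow> nat) \<Rightarrow> bool" where
  "cond_D1 P Q \<alpha> \<longleftrightarrow>
     (\<lambda>p. real (\<alpha> p)) \<in> o(\<lambda>p. real p) \<and>
     (\<forall>p\<ge>1. 1 \<le> \<alpha> p \<and> m_dependent p (P p) (\<alpha> p) \<and> m_dependent p (Q p) (\<alpha> p))"

definition cond_D2 :: "(nat \<Rightarrow> vec measure) \<Rightarrow> (nat \<Rightarrow> vec measure) \<Rightarrow> bool" where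
  "cond_D2 P Q \<longleftrightarrow>
     (\<exists>U::real. 0 < U \<and> (\<forall>p\<ge>1. \<forall>j\<in>{1..p}. \<forall>r\<in>{1..128}.
        (\<integral>\<^sup>+x. ennreal (\<bar>x j\<bar> ^ r) \<partial>P p) < ennreal U \<and>
        (\<integral>\<^sup>+x. ennreal (\<bar>x j\<bar> ^ r) \<partial>Q p) < ennreal U))"

definition cond_D3 :: "(nat \<Rightarrow> vec measure) \<Rightarrow> (nat \<Rightarrow> vec measure) \<Rightarrow> bool" where
  "cond_D3 P Q \<longleftrightarrow>
     (\<exists>L U. 0 < L \<and> 0 < U \<and> (\<forall>p\<ge>1.
        let S = {mean_sq_dist p (P p) (P p), mean_sq_dist p (P p) (Q p),
                 mean_sq_dist p (Q p) (Q p)}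
        in L * real p \<le> Min S \<and> Max S \<le> U * real p))"

definition two_samples ::
    "nat \<Rightarrow> 'a measure \<Rightarrow> vec measure \<Rightarrow> vec measure \<Rightarrow>
     (nat \<Rightarrow> 'a \<Rightarrow> vec) \<Rightarrow> (nat \<Rightarrow> 'a \<Rightarrow> vec) \<Rightarrow> bool" where
  "two_samples p \<Omega> P Q X Y \<longleftrightarrow>
     prob_space \<Omega> \<and>
     prob_space.indep_vars \<Omega> (\<lambda>_. Rp p) (case_sum X Y) ({1..} <+> {1..}) \<and>
     (\<forall>i\<ge>1. distr \<Omega> (Rp p) (X i) = P \<and> distr \<Omega> (Rp p) (Y i) = Q)"

definition energy_stat :: "kern \<Rightarrow> nat \<Rightarrow> nat \<Rightarrow> (nat \<Rightarrow> vec) \<Rightarrow> (nat \<Rightarrow> vec) \<Rightarrow> real" where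
  "energy_stat k n m x y =
     2 / (real n * real m) * (\<Sum>i=1..n. \<Sum>j=1..m. k (x i) (y j))
     - (\<Sum>j=1..n. \<Sum>i=1..<j. k (x i) (x j)) / real (n choose 2)
     - (\<Sum>j=1..m. \<Sum>i=1..<j. k (y i) (y j)) / real (m choose 2)"

definition c_nm :: "nat \<Rightarrow> nat \<Rightarrow> real" where
  "c_nm n m = 2 / (real n * (real n - 1)) + 4 / (real n * real m) + 2 / (real m * (real m - 1))"

definition pooled :: "nat \<Rightarrow> (nat \<Rightarrow> vec) \<Rightarrow> (nat \<Rightarrow> vec) \<Rightarrow> nat \<Rightarrow> vec" where
  "pooled n x y s = (if s \<le> n then x s else y (s - n))"

definition centred :: "nat \<Rightarrow> (nat \<Rightarrow> nat \<Rightarrow> real) \<Rightarrow> nat \<Rightarrow> nat \<Rightarrow> real" where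
  "centred N a s t =
     a s t
     - (\<Sum>i=1..N. a i t) / (real N - 2)
     - (\<Sum>j=1..N. a s j) / (real N - 2)
     + (\<Sum>i=1..N. \<Sum>j=1..N. a i j) / ((real N - 1) * (real N - 2))"

(* The argument a0 is the constant diagonal value k x x. *)
definition variance_stat ::
    "kern \<Rightarrow> real \<Rightarrow> nat \<Rightarrow> nat \<Rightarrow> (nat \<Rightarrow> vec) \<Rightarrow> (nat \<Rightarrow> vec) \<Rightarrow> real" where
  "variance_stat k a0 n m x y =
     (let N = n + m; W = pooled n x y; a = (\<lambda>s t. k (W s) (W t))
      in (\<Sum>s=1..N. \<Sum>t\<in>{1..N}-{s}. (centred N a s t)\<^sup>2) / (real N * (real N - 3))
         - a0\<^sup>2 / ((real N - 1) * (real N - 3)))"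

(* For N \<ge> 4 and a symmetric k with constant diagonal a0, variance_stat is non-negative; if it
   vanishes, the quotient below is 0 and hence does not exceed a positive threshold. *)
definition T_stat ::
    "kern \<Rightarrow> real \<Rightarrow> nat \<Rightarrow> nat \<Rightarrow> (nat \<Rightarrow> vec) \<Rightarrow> (nat \<Rightarrow> vec) \<Rightarrow> real" where
  "T_stat k a0 n m x y =
     energy_stat k n m x y / sqrt (c_nm n m * variance_stat k a0 n m x y)"

end

theory Submission
  imports Defs
begin

text \<open>
Why the test is consistent. In high dimension all distances are nearly deterministic: the squared
distance between two sample points is a sum of \<open>p\<close> coordinatewise terms with dependence of bounded range,
so its variance is of order \<open>p\<close>, like its mean. The distance itself therefore differs from the
constant \<open>A0\<close> of its kind (within the first sample, within the second, between the samples) only by a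
bounded amount on average (\<open>squared_distance_concentration\<close>). The bound on the first derivative of the
profile \<open>f\<close> says that over such a bounded distance \<open>f\<close> changes only by \<open>O(1 / \<surd>p)\<close> times
\<open>F = \<bar>f (A0 p P Q)\<bar>\<close>. So every kernel value is close to one of three constants, in mean and relative
to \<open>F\<close> (\<open>kernel_moments\<close>).

Numerator. The energy statistic is close to \<open>2 f (A0 p P Q) - f (A0 p P P) - f (A0 p Q Q)\<close>. Its
absolute value is at least \<open>L_star F\<close> by hypothesis. Its sign is positive for large \<open>p\<close>: it approximates
the population energy distance, which is nonnegative. For kernels of strong negative type this is part of
the definition. If \<open>- k\<close> is a reproducing kernel, it follows from positive semidefiniteness on
the sample points, after taking expectations (\<open>energy_distance_nonneg\<close>).

Denominator. The variance statistic is at most a multiple of the mean square of the kernel matrix, which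
is of order \<open>F\<^sup>2\<close>, whereas \<open>c_nm\<close> tends to zero; hence the denominator is of smaller order than \<open>F\<close>. It
must also be nonzero. The variance statistic is a sum of squares and vanishes only if the off-diagonal
kernel matrix is a sum of a row term and a column term (\<open>variance_stat_zero_imp_additive\<close>), and this is
incompatible with the gap that bounds the numerator from below.

Both estimates hold outside events whose probability is bounded by Markov's inequality, uniformly in the
dimension (\<open>T_stat_prob_lower_bound\<close>), and \<open>F\<close> cancels.
\<close>

section \<open>The energy and variance statistics as functions of the kernel matrix\<close>

text \<open>The centring annihilates constants only up to a term of order \<open>1 / N\<close>: on the constant matrix
1 it takes the value \<open>1 - 2 N / (N - 2) + N\<^sup>2 / ((N - 1) (N - 2)) = - 1 / (N - 1)\<close>. This is what the
diagonal value \<open>a0\<close> contributes to the centred matrix.\<close>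

lemma centred_diff_const:
  assumes "3 \<le> N"
  shows "centred N a s t = centred N (\<lambda>s t. a s t - c) s t - c / (real N - 1)"
proof -
  have N: "real N - 1 \<noteq> 0" "real N - 2 \<noteq> 0" "real N - 1 > 0" "real N - 2 > 0" using assms by auto
  have "1 - 2 * (N / (real N - 2)) + N * N / ((real N - 1) * (real N - 2)) = - 1 / (real N - 1)"
    using N by (simp add: divide_simps) (simp add: algebra_simps)
  then have "c * (1 - 2 * (N / (real N - 2)) + N * N / ((real N - 1) * (real N - 2))) = - c / (real N - 1)"
    by (metis mult_minus_right mult.right_neutral minus_divide_left times_divide_eq_right)
  then show ?thesis
    by (simp add: centred_def sum_subtractf algebra_simps diff_divide_distrib)
qed

lemma sum_off_diagonal:
  fixes g :: "nat \<Rightarrow> nat \<Rightarrow> real"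
  shows "(\<Sum>s=1..N. \<Sum>t\<in>{1..N}-{s}. g s t) = (\<Sum>s=1..N. \<Sum>t=1..N. g s t) - (\<Sum>s=1..N. g s s)"
  by (simp add: sum_diff1 sum_subtractf)

text \<open>The factors \<open>N - 2\<close> and \<open>(N - 1) (N - 2)\<close> are those of U-centring: once the diagonal of the matrix
is zero, the off-diagonal centred entries add up to zero.\<close>

lemma sum_centred_off_diagonal:
  assumes "3 \<le> N" and diag: "\<And>s. s \<in> {1..N} \<Longrightarrow> b s s = 0"
  shows "(\<Sum>s=1..N. \<Sum>t\<in>{1..N}-{s}. centred N b s t) = 0"
proof -
  define S where "S = (\<Sum>s=1..N. \<Sum>t=1..N. b s t)"
  have S': "(\<Sum>t=1..N. \<Sum>s=1..N. b s t) = S"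
    unfolding S_def by (rule sum.swap)
  have N: "real N - 1 > 0" "real N - 2 > 0" using assms by auto
  have d: "(\<Sum>s=1..N. b s s) = 0" using diag by simp
  have all: "(\<Sum>s=1..N. \<Sum>t=1..N. centred N b s t)
      = S - N * S / (real N - 2) - N * S / (real N - 2) + N * N * S / ((real N - 1) * (real N - 2))"
    by (simp add: centred_def sum.distrib sum_subtractf S' del: One_nat_def flip: sum_divide_distrib sum_distrib_left S_def)
  have dg: "(\<Sum>s=1..N. centred N b s s)
      = - S / (real N - 2) - S / (real N - 2) + N * S / ((real N - 1) * (real N - 2))"
    by (simp add: centred_def sum.distrib sum_subtractf S' d del: One_nat_def flip: sum_divide_distrib sum_distrib_left S_def)
  show ?thesis
    unfolding sum_off_diagonal all dg using N
    by (simp add: divide_simps) (simp add: algebra_simps)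
qed

text \<open>Subtract \<open>a0\<close> from the kernel matrix, so that its diagonal vanishes. The cross term in the square then
disappears, and the square of the shift \<open>a0 / (N - 1)\<close>, summed over the off-diagonal, is exactly the
correction in the definition of the statistic. What remains is a sum of squares, which gives both
nonnegativity and a description of when the statistic vanishes.\<close>

lemma variance_stat_eq:
  assumes N: "4 \<le> n + m" and diag: "\<And>s. s \<in> {1..n + m} \<Longrightarrow> k (pooled n x y s) (pooled n x y s) = a0"
  shows "variance_stat k a0 n m x y =
    (\<Sum>s=1..n + m. \<Sum>t\<in>{1..n + m}-{s}.
       (centred (n + m) (\<lambda>s t. k (pooled n x y s) (pooled n x y t) - a0) s t)\<^sup>2) /
    (real (n + m) * (real (n + m) - 3))"
proof -
  define N where "N = n + m"
  define a where "a = (\<lambda>s t. k (pooled n x y s) (pooled n x y t))"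
  define b where "b = (\<lambda>s t. a s t - a0)"
  define c where "c = a0 / (real N - 1)"
  have N4: "4 \<le> N" using N by (simp add: N_def)
  have bd: "\<And>s. s \<in> {1..N} \<Longrightarrow> b s s = 0" using diag by (auto simp: b_def a_def N_def)
  have card: "(\<Sum>s=1..N. \<Sum>t\<in>{1..N}-{s}. (1::real)) = N * (real N - 1)"
    using N4 by (simp add: of_nat_diff)
  have "(\<Sum>s=1..N. \<Sum>t\<in>{1..N}-{s}. (centred N a s t)\<^sup>2)
     = (\<Sum>s=1..N. \<Sum>t\<in>{1..N}-{s}. (centred N b s t)\<^sup>2 - 2 * c * centred N b s t + c\<^sup>2 * 1)"
    unfolding b_def c_def using N4
    by (subst centred_diff_const[of N a _ _ a0]) (simp_all add: power2_diff algebra_simps)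
  also have "\<dots> = (\<Sum>s=1..N. \<Sum>t\<in>{1..N}-{s}. (centred N b s t)\<^sup>2)
      - 2 * c * (\<Sum>s=1..N. \<Sum>t\<in>{1..N}-{s}. centred N b s t)
      + c\<^sup>2 * (\<Sum>s=1..N. \<Sum>t\<in>{1..N}-{s}. 1)"
    by (simp only: sum.distrib sum_subtractf sum_distrib_left)
  also have "\<dots> = (\<Sum>s=1..N. \<Sum>t\<in>{1..N}-{s}. (centred N b s t)\<^sup>2) + c\<^sup>2 * (N * (real N - 1))"
    using sum_centred_off_diagonal[of N b] N4 bd card by simp
  finally have *: "(\<Sum>s=1..N. \<Sum>t\<in>{1..N}-{s}. (centred N a s t)\<^sup>2)
    = (\<Sum>s=1..N. \<Sum>t\<in>{1..N}-{s}. (centred N b s t)\<^sup>2) + c\<^sup>2 * (N * (real N - 1))" .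
  have "c\<^sup>2 * (N * (real N - 1)) / (real N * (real N - 3)) = a0\<^sup>2 / ((real N - 1) * (real N - 3))"
    using N4 by (simp add: c_def power2_eq_square divide_simps)
  with * show ?thesis
    unfolding variance_stat_def Let_def N_def[symmetric] a_def[symmetric]
    by (simp only: add_divide_distrib b_def a_def)
qed

lemma variance_stat_nonneg:
  assumes N: "4 \<le> n + m" and diag: "\<And>s. s \<in> {1..n + m} \<Longrightarrow> k (pooled n x y s) (pooled n x y s) = a0"
  shows "0 \<le> variance_stat k a0 n m x y"
  using N by (subst variance_stat_eq[of n m k x y a0, OF N diag]) (auto intro!: divide_nonneg_nonneg sum_nonneg)

text \<open>If all off-diagonal centred entries are zero, then off the diagonal the kernel matrix has the form
\<open>u t + v s\<close>, and such a matrix has zero second difference over any two rows and two columns with four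
distinct indices. This relation fails when within-sample and between-sample values are
well separated.\<close>

lemma variance_stat_zero_imp_additive:
  assumes n: "2 \<le> n" "2 \<le> m"
    and diag: "\<And>s. s \<in> {1..n + m} \<Longrightarrow> k (pooled n x y s) (pooled n x y s) = a0"
    and zero: "variance_stat k a0 n m x y = 0"
  shows "k (x 1) (x 2) + k (y 1) (y 2) = k (x 1) (y 2) + k (y 1) (x 2)"
proof -
  define N where "N = n + m"
  define b where "b = (\<lambda>s t. k (pooled n x y s) (pooled n x y t) - a0)"
  have N4: "4 \<le> N" using n by (simp add: N_def)
  have "(\<Sum>s=1..N. \<Sum>t\<in>{1..N}-{s}. (centred N b s t)\<^sup>2) = 0"
    using zero N4 variance_stat_eq[of n m k x y a0, OF N4[unfolded N_def] diag, folded b_def N_def]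
    by simp
  then have z: "centred N b s t = 0" if "s \<in> {1..N}" "t \<in> {1..N}" "s \<noteq> t" for s t
    using that by (simp add: sum_nonneg_eq_0_iff sum_nonneg)
  define u where "u = (\<lambda>t. (\<Sum>i=1..N. b i t) / (real N - 2))"
  define v where "v = (\<lambda>s. (\<Sum>j=1..N. b s j) / (real N - 2)
       - (\<Sum>i=1..N. \<Sum>j=1..N. b i j) / ((real N - 1) * (real N - 2)))"
  have add: "b s t = u t + v s" if "s \<in> {1..N}" "t \<in> {1..N}" "s \<noteq> t" for s t
    using z[OF that] by (simp add: centred_def u_def v_def)
  have "b 1 2 + b (n + 1) (n + 2) = b 1 (n + 2) + b (n + 1) 2"
    using n by (subst (1 2 3 4) add) (auto simp: N_def)
  then show ?thesis using n by (simp add: b_def pooled_def)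
qed

lemma sum_power2_le:
  fixes g :: "nat \<Rightarrow> real"
  shows "(\<Sum>i=1..N. g i)\<^sup>2 \<le> N * (\<Sum>i=1..N. (g i)\<^sup>2)"
  using Cauchy_Schwarz_ineq_sum[of "\<lambda>_. 1" g "{1..N}"] by simp

text \<open>A crude bound: by Cauchy--Schwarz, row means, column means and the overall mean of the matrix have no
larger mean square than its entries, up to a numerical factor. Nothing sharper is wanted, because the
statistic enters the test only after multiplication by \<open>c_nm\<close>, which tends to zero.\<close>

lemma variance_stat_upper:
  assumes N: "4 \<le> n + m"
  shows "variance_stat k a0 n m x y \<le> 400 / (real (n + m))\<^sup>2 *
    (\<Sum>s=1..n + m. \<Sum>t=1..n + m. (k (pooled n x y s) (pooled n x y t))\<^sup>2)"
proof -
  define N where "N = n + m"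
  define a where "a = (\<lambda>s t. k (pooled n x y s) (pooled n x y t))"
  define S where "S = (\<Sum>s=1..N. \<Sum>t=1..N. (a s t)\<^sup>2)"
  define r where "r = real N"
  have r: "4 \<le> r" using N by (simp add: r_def N_def)
  define row col tot where "row = (\<lambda>s. (\<Sum>j=1..N. a s j))" and "col = (\<lambda>t. (\<Sum>i=1..N. a i t))"
    and "tot = (\<Sum>i=1..N. \<Sum>j=1..N. a i j)"
  have S0: "0 \<le> S" by (auto simp: S_def intro!: sum_nonneg)
  have q1: "r / (r - 2) \<le> 2" "r / (r - 1) \<le> 2" "r / (r - 3) \<le> 4" "0 \<le> r / (r - 2)" "0 \<le> r / (r - 1)"
    using r by (auto simp: divide_simps)
  have rows: "(\<Sum>s=1..N. (row s)\<^sup>2) \<le> r * S"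
    unfolding S_def sum_distrib_left r_def row_def by (intro sum_mono sum_power2_le[unfolded sum_distrib_left])
  have cols: "(\<Sum>t=1..N. (col t)\<^sup>2) \<le> r * S"
    unfolding S_def sum.swap[of "\<lambda>s t. (a s t)\<^sup>2"] sum_distrib_left r_def col_def
    by (intro sum_mono sum_power2_le[unfolded sum_distrib_left])
  have "tot\<^sup>2 \<le> r * (\<Sum>s=1..N. (row s)\<^sup>2)"
    unfolding tot_def row_def[symmetric] r_def by (rule sum_power2_le)
  also have "\<dots> \<le> r * (r * S)" using rows r by (intro mult_left_mono) auto
  finally have tot: "tot\<^sup>2 \<le> r * (r * S)" .
  have cen: "centred N a s t = a s t - col t / (r - 2) - row s / (r - 2) + tot / ((r - 1) * (r - 2))" for s t
    by (simp only: centred_def row_def col_def tot_def r_def)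
  have four: "(w - u - v + z)\<^sup>2 \<le> 4 * (w\<^sup>2 + u\<^sup>2 + v\<^sup>2 + z\<^sup>2)" for u v w z :: real
  proof -
    have "4 * (w\<^sup>2 + u\<^sup>2 + v\<^sup>2 + z\<^sup>2) - (w - u - v + z)\<^sup>2
        = (w + u)\<^sup>2 + (w + v)\<^sup>2 + (w - z)\<^sup>2 + (u - v)\<^sup>2 + (u + z)\<^sup>2 + (v + z)\<^sup>2"
      by (simp add: power2_eq_square algebra_simps)
    also have "\<dots> \<ge> 0" by (intro add_nonneg_nonneg) auto
    finally show ?thesis by simp
  qed
  have "(\<Sum>s=1..N. \<Sum>t\<in>{1..N}-{s}. (centred N a s t)\<^sup>2) \<le> (\<Sum>s=1..N. \<Sum>t=1..N. (centred N a s t)\<^sup>2)"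
    by (intro sum_mono sum_mono2) auto
  also have "\<dots> \<le> (\<Sum>s=1..N. \<Sum>t=1..N. 4 * ((a s t)\<^sup>2 + (col t / (r - 2))\<^sup>2 + (row s / (r - 2))\<^sup>2
      + (tot / ((r - 1) * (r - 2)))\<^sup>2))"
    unfolding cen by (intro sum_mono four)
  also have "\<dots> = 4 * (S + r * (\<Sum>t=1..N. (col t)\<^sup>2) / (r - 2)\<^sup>2 + r * (\<Sum>s=1..N. (row s)\<^sup>2) / (r - 2)\<^sup>2
      + r * r * tot\<^sup>2 / ((r - 1) * (r - 2))\<^sup>2)"
    by (simp add: sum.distrib S_def r_def power_divide flip: sum_distrib_left sum_divide_distrib)
       (simp add: algebra_simps)
  also have "\<dots> \<le> 4 * (S + r * (r * S) / (r - 2)\<^sup>2 + r * (r * S) / (r - 2)\<^sup>2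
      + r * r * (r * (r * S)) / ((r - 1) * (r - 2))\<^sup>2)"
    using r rows cols tot by (intro mult_left_mono add_mono divide_right_mono order.refl) auto
  also have "\<dots> = 4 * (1 + 2 * (r / (r - 2))\<^sup>2 + (r / (r - 1))\<^sup>2 * (r / (r - 2))\<^sup>2) * S"
    by (simp add: power2_eq_square algebra_simps add_divide_distrib)
  \<comment> \<open>For \<open>N \<ge> 4\<close> both ratios are at most 2, whence \<open>4 (1 + 8 + 16) = 100\<close>.\<close>
  also have "\<dots> \<le> 4 * (1 + 2 * 2\<^sup>2 + 2\<^sup>2 * 2\<^sup>2) * S"
    using q1 S0 by (intro mult_right_mono mult_left_mono add_mono mult_mono power_mono order.refl) auto
  finally have "(\<Sum>s=1..N. \<Sum>t\<in>{1..N}-{s}. (centred N a s t)\<^sup>2) \<le> 100 * S" by simp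
  then have "variance_stat k a0 n m x y \<le> 100 * S / (r * (r - 3)) - a0\<^sup>2 / ((r - 1) * (r - 3))"
    unfolding variance_stat_def Let_def N_def[symmetric] a_def[symmetric] r_def[symmetric]
    using r by (intro diff_right_mono divide_right_mono) auto
  also have "\<dots> \<le> 100 * S / (r * (r - 3))" using r by simp
  also have "\<dots> = 100 * S / r\<^sup>2 * (r / (r - 3))" using r by (simp add: power2_eq_square)
  also have "\<dots> \<le> 100 * S / r\<^sup>2 * 4" using q1 S0 by (intro mult_left_mono) auto
  finally show ?thesis by (simp add: S_def r_def a_def N_def)
qed

text \<open>Averaged absolute distances of the three kinds of kernel values from prescribed constants. Unlike the
energy statistic this quantity is nonnegative, so its expectation controls it through Markov's
inequality.\<close>

definition energy_deviation ::
    "kern \<Rightarrow> nat \<Rightarrow> nat \<Rightarrow> (nat \<Rightarrow> vec) \<Rightarrow> (nat \<Rightarrow> vec) \<Rightarrow> real \<Rightarrow> real \<Rightarrow> real \<Rightarrow> real" where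
  "energy_deviation k n m x y a b c =
     2 / (real n * real m) * (\<Sum>i=1..n. \<Sum>j=1..m. \<bar>k (x i) (y j) - a\<bar>)
     + (\<Sum>j=1..n. \<Sum>i=1..<j. \<bar>k (x i) (x j) - b\<bar>) / real (n choose 2)
     + (\<Sum>j=1..m. \<Sum>i=1..<j. \<bar>k (y i) (y j) - c\<bar>) / real (m choose 2)"

lemma sum_pairs_const: "(\<Sum>j=1..n. \<Sum>i=1..<j. (c::real)) = real (n choose 2) * c"
proof (induction n)
  case (Suc n)
  then show ?case by (simp add: numeral_2_eq_2 algebra_simps)
qed simp

lemma energy_stat_diff:
  assumes n: "2 \<le> n" "2 \<le> m"
  shows "\<bar>energy_stat k n m x y - (2 * a - b - c)\<bar> \<le> energy_deviation k n m x y a b c"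
proof -
  have pos: "0 < real (n choose 2)" "0 < real (m choose 2)" "0 < real n * real m"
    using n by (auto simp: zero_less_binomial_iff)
  have avg: "(\<Sum>j=1..l. \<Sum>i=1..<j. g i j) / real (l choose 2) - e
     = (\<Sum>j=1..l. \<Sum>i=1..<j. g i j - e) / real (l choose 2)" if "0 < real (l choose 2)" for l e and g :: "nat \<Rightarrow> nat \<Rightarrow> real"
    using that unfolding sum_subtractf sum_pairs_const by (simp add: field_simps)
  have sabs: "\<bar>\<Sum>i\<in>A. \<Sum>j\<in>B i. g i j\<bar> \<le> (\<Sum>i\<in>A. \<Sum>j\<in>B i. \<bar>g i j\<bar>)"
    for A :: "nat set" and B and g :: "nat \<Rightarrow> nat \<Rightarrow> real"
    by (rule order.trans[OF sum_abs sum_mono[OF sum_abs]])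
  have abs3: "\<bar>u - v - w\<bar> \<le> \<bar>u\<bar> + \<bar>v\<bar> + \<bar>w\<bar>" for u v w :: real by linarith
  have "energy_stat k n m x y - (2 * a - b - c)
     = (2 / (real n * real m) * (\<Sum>i=1..n. \<Sum>j=1..m. k (x i) (y j)) - 2 * a)
       - ((\<Sum>j=1..n. \<Sum>i=1..<j. k (x i) (x j)) / real (n choose 2) - b)
       - ((\<Sum>j=1..m. \<Sum>i=1..<j. k (y i) (y j)) / real (m choose 2) - c)"
    by (simp add: energy_stat_def)
  also have "\<dots> =
     2 / (real n * real m) * (\<Sum>i=1..n. \<Sum>j=1..m. k (x i) (y j) - a)
     - (\<Sum>j=1..n. \<Sum>i=1..<j. k (x i) (x j) - b) / real (n choose 2)
     - (\<Sum>j=1..m. \<Sum>i=1..<j. k (y i) (y j) - c) / real (m choose 2)"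
    using n unfolding avg[OF pos(1)] avg[OF pos(2)] by (simp add: sum_subtractf right_diff_distrib)
  finally have diff: "energy_stat k n m x y - (2 * a - b - c) =
     2 / (real n * real m) * (\<Sum>i=1..n. \<Sum>j=1..m. k (x i) (y j) - a)
     - (\<Sum>j=1..n. \<Sum>i=1..<j. k (x i) (x j) - b) / real (n choose 2)
     - (\<Sum>j=1..m. \<Sum>i=1..<j. k (y i) (y j) - c) / real (m choose 2)" .
  have "\<bar>energy_stat k n m x y - (2 * a - b - c)\<bar> \<le> \<bar>2 / (real n * real m) * (\<Sum>i=1..n. \<Sum>j=1..m. k (x i) (y j) - a)\<bar>
     + \<bar>(\<Sum>j=1..n. \<Sum>i=1..<j. k (x i) (x j) - b) / real (n choose 2)\<bar>
     + \<bar>(\<Sum>j=1..m. \<Sum>i=1..<j. k (y i) (y j) - c) / real (m choose 2)\<bar>" unfolding diff by (rule abs3)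
  also have "\<dots> \<le> energy_deviation k n m x y a b c"
    unfolding energy_deviation_def abs_mult abs_divide abs_of_pos[OF pos(1)] abs_of_pos[OF pos(2)] abs_of_nat abs_numeral
    by (intro add_mono mult_left_mono divide_right_mono sabs less_imp_le[OF pos(1)] less_imp_le[OF pos(2)]
          divide_nonneg_pos[OF _ pos(3)] zero_le_numeral)
  finally show ?thesis .
qed

section \<open>Concentration of distances under short-range dependence\<close>

lemma integrable_mult_of_squares:
  fixes g h :: "'a \<Rightarrow> real"
  assumes [measurable]: "g \<in> borel_measurable M" "h \<in> borel_measurable M"
    and "integrable M (\<lambda>x. (g x)\<^sup>2)" "integrable M (\<lambda>x. (h x)\<^sup>2)"
  shows "integrable M (\<lambda>x. g x * h x)"
proof (rule Bochner_Integration.integrable_bound)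
  show "integrable M (\<lambda>x. (g x)\<^sup>2 + (h x)\<^sup>2)" using assms by simp
  show "AE x in M. norm (g x * h x) \<le> norm ((g x)\<^sup>2 + (h x)\<^sup>2)"
  proof (rule AE_I2)
    fix x
    have "2 * (\<bar>g x\<bar> * \<bar>h x\<bar>) \<le> (g x)\<^sup>2 + (h x)\<^sup>2"
      using sum_squares_bound[of "\<bar>g x\<bar>" "\<bar>h x\<bar>"] by simp
    moreover have "0 \<le> \<bar>g x\<bar> * \<bar>h x\<bar>" by simp
    ultimately show "norm (g x * h x) \<le> norm ((g x)\<^sup>2 + (h x)\<^sup>2)"
      unfolding real_norm_def abs_mult by linarith
  qed
qed simp

text \<open>Expand the square of the centred sum. Pairs of indices further apart than \<open>a\<close> contribute nothing. Each
index lies within distance \<open>a\<close> of at most \<open>2 a + 1\<close> indices, and each such pair contributes at most \<open>K\<close> by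
the arithmetic-geometric mean inequality; so the variance is linear in \<open>p\<close>.\<close>

lemma (in prob_space) variance_sum_locally_dependent:
  fixes h :: "nat \<Rightarrow> 'a \<Rightarrow> real"
  assumes meas: "\<And>i. i \<in> {1..p} \<Longrightarrow> h i \<in> borel_measurable M"
    and int: "\<And>i. i \<in> {1..p} \<Longrightarrow> integrable M (\<lambda>x. (h i x)\<^sup>2)"
    and bound: "\<And>i. i \<in> {1..p} \<Longrightarrow> expectation (\<lambda>x. (h i x)\<^sup>2) \<le> K"
    and uncorrelated: "\<And>i j. \<lbrakk>i \<in> {1..p}; j \<in> {1..p}; i + a < j\<rbrakk> \<Longrightarrow>
      expectation (\<lambda>x. h i x * h j x) = expectation (h i) * expectation (h j)"
  shows "integrable M (\<lambda>x. (\<Sum>i=1..p. h i x))"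
    and "integrable M (\<lambda>x. ((\<Sum>i=1..p. h i x) - expectation (\<lambda>x. \<Sum>i=1..p. h i x))\<^sup>2)"
    and "variance (\<lambda>x. \<Sum>i=1..p. h i x) \<le> K * (real p * (2 * real a + 1))"
proof -
  define g where "g = (\<lambda>i x. h i x - expectation (h i))"
  have h1: "integrable M (h i)" if "i \<in> {1..p}" for i
    using square_integrable_imp_integrable[OF meas int] that by simp
  have gm: "g i \<in> borel_measurable M" if "i \<in> {1..p}" for i
    using meas[OF that] unfolding g_def by measurable
  have g2: "integrable M (\<lambda>x. (g i x)\<^sup>2)" "expectation (\<lambda>x. (g i x)\<^sup>2) \<le> K" if "i \<in> {1..p}" for i
  proof -
    show "integrable M (\<lambda>x. (g i x)\<^sup>2)"
      using h1[OF that] int[OF that] by (simp add: g_def power2_diff)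
    have "expectation (\<lambda>x. (g i x)\<^sup>2) = expectation (\<lambda>x. (h i x)\<^sup>2) - (expectation (h i))\<^sup>2"
      unfolding g_def using h1[OF that] int[OF that] by (rule variance_eq)
    then show "expectation (\<lambda>x. (g i x)\<^sup>2) \<le> K"
      using bound[OF that] zero_le_power2[of "expectation (h i)"] by linarith
  qed
  have gg: "integrable M (\<lambda>x. g i x * g j x)" if "i \<in> {1..p}" "j \<in> {1..p}" for i j
    using that by (intro integrable_mult_of_squares gm g2)
  have hh: "integrable M (\<lambda>x. h i x * h j x)" if "i \<in> {1..p}" "j \<in> {1..p}" for i j
    using that by (intro integrable_mult_of_squares meas int)
  have far: "expectation (\<lambda>x. g i x * g j x) = 0" if ij: "i \<in> {1..p}" "j \<in> {1..p}" "i + a < j" for i j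
  proof -
    have "expectation (\<lambda>x. g i x * g j x) = expectation (\<lambda>x. h i x * h j x - h i x * expectation (h j)
        - expectation (h i) * h j x + expectation (h i) * expectation (h j))"
      by (simp add: g_def algebra_simps)
    also have "\<dots> = expectation (\<lambda>x. h i x * h j x) - expectation (h i) * expectation (h j)
        - expectation (h i) * expectation (h j) + expectation (h i) * expectation (h j)"
      using ij h1 hh by (simp add: prob_space)
    finally show ?thesis using uncorrelated[OF ij] by simp
  qed
  have amgm: "u * v \<le> (u\<^sup>2 + v\<^sup>2) / 2" for u v :: real
    using sum_squares_bound[of u v] by simp
  have near: "expectation (\<lambda>x. g i x * g j x) \<le> K" if ij: "i \<in> {1..p}" "j \<in> {1..p}" for i j
  proof -
    have "expectation (\<lambda>x. g i x * g j x) \<le> expectation (\<lambda>x. ((g i x)\<^sup>2 + (g j x)\<^sup>2) / 2)"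
      using ij gg g2 amgm by (intro integral_mono) auto
    also have "\<dots> = (expectation (\<lambda>x. (g i x)\<^sup>2) + expectation (\<lambda>x. (g j x)\<^sup>2)) / 2"
      using ij g2 by simp
    also have "\<dots> \<le> K" using g2(2)[OF ij(1)] g2(2)[OF ij(2)] by simp
    finally show ?thesis .
  qed
  show "integrable M (\<lambda>x. (\<Sum>i=1..p. h i x))" using h1 by (intro Bochner_Integration.integrable_sum)
  have e: "expectation (\<lambda>x. \<Sum>i=1..p. h i x) = (\<Sum>i=1..p. expectation (h i))"
    using h1 by (intro Bochner_Integration.integral_sum)
  have sq: "((\<Sum>i=1..p. h i x) - expectation (\<lambda>x. \<Sum>i=1..p. h i x))\<^sup>2 = (\<Sum>i=1..p. \<Sum>j=1..p. g i x * g j x)" for x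
    unfolding e sum_subtractf[symmetric] g_def power2_eq_square by (rule sum_product)
  show "integrable M (\<lambda>x. ((\<Sum>i=1..p. h i x) - expectation (\<lambda>x. \<Sum>i=1..p. h i x))\<^sup>2)"
    unfolding sq using gg by (intro Bochner_Integration.integrable_sum)
  have "variance (\<lambda>x. \<Sum>i=1..p. h i x) = (\<Sum>i=1..p. \<Sum>j=1..p. expectation (\<lambda>x. g i x * g j x))"
    unfolding sq using gg
    by (subst Bochner_Integration.integral_sum) (auto intro!: sum.cong Bochner_Integration.integral_sum Bochner_Integration.integrable_sum)
  also have "\<dots> \<le> (\<Sum>i=1..p. K * (2 * real a + 1))"
  proof (intro sum_mono)
    fix i assume i: "i \<in> {1..p}"
    have K0: "0 \<le> K"
      using order.trans[OF Bochner_Integration.integral_nonneg bound[OF i]] zero_le_power2 by blast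
    have "(\<Sum>j=1..p. expectation (\<lambda>x. g i x * g j x))
      \<le> (\<Sum>j=1..p. if j \<in> {i - a..i + a} then K else 0)"
    proof (intro sum_mono)
      fix j assume j: "j \<in> {1..p}"
      consider "i + a < j" | "j + a < i" | "j \<in> {i - a..i + a}" by fastforce
      then show "expectation (\<lambda>x. g i x * g j x) \<le> (if j \<in> {i - a..i + a} then K else 0)"
      proof cases
        case 1 then show ?thesis using far[OF i j 1] by auto
      next
        case 2 then show ?thesis using far[OF j i 2] by (auto simp: mult.commute)
      next
        case 3 then show ?thesis using near[OF i j] by simp
      qed
    qed
    also have "\<dots> = K * real (card ({1..p} \<inter> {i - a..i + a}))"
      by (simp add: sum.If_cases Int_def)
    also have "\<dots> \<le> K * (2 * real a + 1)"
    proof (rule mult_left_mono[OF _ K0])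
      have "card ({1..p} \<inter> {i - a..i + a}) \<le> card {i - a..i + a}" by (intro card_mono) auto
      also have "\<dots> \<le> 2 * a + 1" by simp
      finally have "real (card ({1..p} \<inter> {i - a..i + a})) \<le> real (2 * a + 1)"
        by (rule of_nat_mono)
      then show "real (card ({1..p} \<inter> {i - a..i + a})) \<le> 2 * real a + 1" by simp
    qed
    finally show "(\<Sum>j=1..p. expectation (\<lambda>x. g i x * g j x)) \<le> K * (2 * real a + 1)" .
  qed
  finally show "variance (\<lambda>x. \<Sum>i=1..p. h i x) \<le> K * (real p * (2 * real a + 1))"
    by (simp add: ac_simps)
qed

definition short_range_law :: "nat \<Rightarrow> nat \<Rightarrow> real \<Rightarrow> vec measure \<Rightarrow> bool" where
  "short_range_law p a U P \<longleftrightarrow> borel_prob p P \<and> m_dependent p P a \<and>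
     (\<forall>j\<in>{1..p}. (\<integral>\<^sup>+x. ennreal (\<bar>x j\<bar> ^ 4) \<partial>P) < ennreal U)"

lemma borel_prob_coordinate_measurable:
  assumes "borel_prob p P" "j \<in> {1..p}"
  shows "(\<lambda>x. x j) \<in> borel_measurable P"
proof -
  have s: "sets P = sets (Rp p)" using assms by (simp add: borel_prob_def)
  show ?thesis unfolding measurable_cong_sets[OF s refl] Rp_def
    using assms(2) by (rule measurable_component_singleton)
qed

lemma short_range_law_moments:
  assumes law: "short_range_law p a U P" and j: "j \<in> {1..p}"
  shows "integrable P (\<lambda>x. (x j) ^ 4)" "(LINT x|P. (x j) ^ 4) \<le> U"
    and "integrable P (\<lambda>x. (x j)\<^sup>2)" "integrable P (\<lambda>x. x j)"
proof -
  interpret prob_space P using law by (simp add: short_range_law_def borel_prob_def)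
  have [measurable]: "(\<lambda>x. x j) \<in> borel_measurable P"
    using borel_prob_coordinate_measurable law j by (auto simp: short_range_law_def)
  have p4: "(u\<^sup>2)\<^sup>2 = u ^ 4" for u :: real
    by (simp add: power2_eq_square power4_eq_xxxx)
  have nn: "(\<integral>\<^sup>+x. ennreal ((x j) ^ 4) \<partial>P) < ennreal U"
    using law j by (auto simp: short_range_law_def)
  show i4: "integrable P (\<lambda>x. (x j) ^ 4)"
    by (rule integrableI_bounded) (use nn in \<open>auto intro: order.strict_trans simp: ennreal_less_top\<close>)
  have "ennreal (LINT x|P. (x j) ^ 4) < ennreal U"
    using nn nn_integral_eq_integral[OF i4] by simp
  then show "(LINT x|P. (x j) ^ 4) \<le> U"
    by (rule contrapos_pp) (auto intro!: leD ennreal_leI)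
  show i2: "integrable P (\<lambda>x. (x j)\<^sup>2)"
    by (rule square_integrable_imp_integrable) (simp_all add: p4 i4)
  show "integrable P (\<lambda>x. x j)"
    by (rule square_integrable_imp_integrable[OF _ i2]) simp
qed

lemma short_range_law_bound_nonneg:
  assumes "short_range_law p a U P" "1 \<le> p"
  shows "0 \<le> U"
proof -
  have "0 \<le> (LINT x|P. (x 1) ^ 4)" by (rule Bochner_Integration.integral_nonneg) simp
  also have "\<dots> \<le> U" using short_range_law_moments(2)[OF assms(1), of 1] assms(2) by simp
  finally show ?thesis .
qed

lemma m_dependent_expectation_mult:
  fixes \<phi> \<psi> :: "real \<Rightarrow> real"
  assumes P: "borel_prob p P" and dep: "m_dependent p P a"
    and ij: "1 \<le> i" "i + a < j" "j \<le> p"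
    and [measurable]: "\<phi> \<in> borel_measurable borel" "\<psi> \<in> borel_measurable borel"
    and int: "integrable P (\<lambda>x. \<phi> (x i))" "integrable P (\<lambda>x. \<psi> (x j))"
  shows "(LINT x|P. \<phi> (x i) * \<psi> (x j)) = (LINT x|P. \<phi> (x i)) * (LINT x|P. \<psi> (x j))"
proof -
  interpret prob_space P using P by (simp add: borel_prob_def)
  have "indep_var (\<Pi>\<^sub>M i\<in>{1..i}. borel) (\<lambda>x. restrict x {1..i})
      (\<Pi>\<^sub>M i\<in>{i + (j - i)..p}. borel) (\<lambda>x. restrict x {i + (j - i)..p})"
    using dep[unfolded m_dependent_def, rule_format, of i "j - i"] ij by auto
  then have ind: "indep_var (\<Pi>\<^sub>M i\<in>{1..i}. borel) (\<lambda>x. restrict x {1..i})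
      (\<Pi>\<^sub>M i\<in>{j..p}. borel) (\<lambda>x. restrict x {j..p})" using ij by simp
  have mi: "(\<lambda>x. \<phi> (x i)) \<in> borel_measurable (\<Pi>\<^sub>M i\<in>{1..i}. borel)"
    by (rule measurable_compose[OF measurable_component_singleton]) (use ij in auto)
  have mj: "(\<lambda>x. \<psi> (x j)) \<in> borel_measurable (\<Pi>\<^sub>M i\<in>{j..p}. borel)"
    by (rule measurable_compose[OF measurable_component_singleton]) (use ij in auto)
  have "indep_var borel (\<lambda>x. \<phi> (x i)) borel (\<lambda>x. \<psi> (x j))"
    using indep_var_compose[OF ind mi mj] ij by (simp add: comp_def)
  then show ?thesis using int by (rule indep_var_lebesgue_integral)
qed

lemma integral_pair_fst:
  fixes g :: "'a \<Rightarrow> real"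
  assumes P: "prob_space P" and Q: "prob_space Q" and g: "integrable P g"
  shows "integrable (P \<Otimes>\<^sub>M Q) (\<lambda>z. g (fst z))" "(LINT z|(P \<Otimes>\<^sub>M Q). g (fst z)) = (LINT x|P. g x)"
proof -
  interpret Q: prob_space Q by (rule Q)
  have [measurable]: "g \<in> borel_measurable P" using g by simp
  show "integrable (P \<Otimes>\<^sub>M Q) (\<lambda>z. g (fst z))"
    using g by (subst (asm) Q.distr_pair_fst[of P, symmetric]) (simp add: integrable_distr_eq)
  show "(LINT z|(P \<Otimes>\<^sub>M Q). g (fst z)) = (LINT x|P. g x)"
    by (subst (2) Q.distr_pair_fst[of P, symmetric]) (simp add: integral_distr)
qed

lemma integral_pair_snd:
  fixes g :: "'a \<Rightarrow> real"
  assumes P: "prob_space P" and Q: "prob_space Q" and g: "integrable Q g"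
  shows "integrable (P \<Otimes>\<^sub>M Q) (\<lambda>z. g (snd z))" "(LINT z|(P \<Otimes>\<^sub>M Q). g (snd z)) = (LINT x|Q. g x)"
proof -
  interpret P: prob_space P by (rule P)
  interpret Q: prob_space Q by (rule Q)
  interpret PQ: pair_sigma_finite P Q ..
  interpret QP: pair_sigma_finite Q P ..
  have [measurable]: "g \<in> borel_measurable Q" using g by simp
  show i: "integrable (P \<Otimes>\<^sub>M Q) (\<lambda>z. g (snd z))"
    using QP.integrable_product_swap[OF integral_pair_fst(1)[OF Q P g]] by (simp add: case_prod_beta')
  show "(LINT z|(P \<Otimes>\<^sub>M Q). g (snd z)) = (LINT x|Q. g x)"
    using PQ.integral_fst'[OF i] by (simp add: P.prob_space)
qed

lemma vdist_sq: "(vdist p x y)\<^sup>2 = (\<Sum>i=1..p. (x i - y i)\<^sup>2)"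
  by (simp add: vdist_def L2_set_def sum_nonneg)

lemma vdist_nonneg: "0 \<le> vdist p x y"
  by (simp add: vdist_def)

text \<open>The squared distance is the sum of \<open>(x i - y i)\<^sup>2\<close>. With \<open>x\<close> held fixed, distant summands are
independent in \<open>y\<close>; integrating over \<open>y\<close> leaves a product of a function of \<open>x i\<close> and a function of \<open>x j\<close>,
which are independent in turn. So distant summands are uncorrelated under the product measure, and the
variance of the squared distance is at most of order \<open>p\<close>.\<close>

lemma squared_distance_concentration:
  assumes P: "short_range_law p a U P" and Q: "short_range_law p a U Q"
  shows "integrable (P \<Otimes>\<^sub>M Q) (\<lambda>z. (vdist p (fst z) (snd z))\<^sup>2)"
    and "integrable (P \<Otimes>\<^sub>M Q) (\<lambda>z. ((vdist p (fst z) (snd z))\<^sup>2 - mean_sq_dist p P Q)\<^sup>2)"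
    and "(LINT z|(P \<Otimes>\<^sub>M Q). ((vdist p (fst z) (snd z))\<^sup>2 - mean_sq_dist p P Q)\<^sup>2)
          \<le> 16 * U * (real p * (2 * real a + 1))"
proof -
  have PS: "prob_space P" "prob_space Q" and bp: "borel_prob p P" "borel_prob p Q"
    and dep: "m_dependent p P a" "m_dependent p Q a"
    using P Q by (auto simp: short_range_law_def borel_prob_def)
  interpret P: prob_space P by (rule PS)
  interpret Q: prob_space Q by (rule PS)
  interpret PQ: pair_prob_space P Q ..
  define h :: "nat \<Rightarrow> vec \<times> vec \<Rightarrow> real" where "h = (\<lambda>i z. (fst z i - snd z i)\<^sup>2)"
  have cm: "(\<lambda>z. fst z i) \<in> borel_measurable (P \<Otimes>\<^sub>M Q)" "(\<lambda>z. snd z i) \<in> borel_measurable (P \<Otimes>\<^sub>M Q)"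
    if "i \<in> {1..p}" for i
    by (rule measurable_compose[OF measurable_fst borel_prob_coordinate_measurable[OF bp(1) that]],
        rule measurable_compose[OF measurable_snd borel_prob_coordinate_measurable[OF bp(2) that]])
  have hm: "h i \<in> borel_measurable (P \<Otimes>\<^sub>M Q)" if "i \<in> {1..p}" for i
    using cm[OF that] unfolding h_def by measurable
  have h2: "(h i z)\<^sup>2 \<le> 8 * ((fst z i) ^ 4 + (snd z i) ^ 4)" for i z
  proof -
    have *: "(u - v)\<^sup>2 \<le> 2 * (u\<^sup>2 + v\<^sup>2)" "(u + v)\<^sup>2 \<le> 2 * (u\<^sup>2 + v\<^sup>2)" for u v :: real
      using sum_squares_bound[of u "- v"] sum_squares_bound[of u v]
      by (simp_all add: power2_diff power2_sum)
    have "(h i z)\<^sup>2 \<le> (2 * ((fst z i)\<^sup>2 + (snd z i)\<^sup>2))\<^sup>2"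
      unfolding h_def by (intro power_mono *) simp
    also have "\<dots> \<le> 4 * (2 * (((fst z i)\<^sup>2)\<^sup>2 + ((snd z i)\<^sup>2)\<^sup>2))"
      unfolding power_mult_distrib by (intro mult_mono *) auto
    finally show ?thesis by (simp flip: power_mult)
  qed
  have int8: "integrable (P \<Otimes>\<^sub>M Q) (\<lambda>z. 8 * ((fst z i) ^ 4 + (snd z i) ^ 4))"
    and int8': "(LINT z|(P \<Otimes>\<^sub>M Q). 8 * ((fst z i) ^ 4 + (snd z i) ^ 4)) \<le> 16 * U" if i: "i \<in> {1..p}" for i
  proof -
    note mP = short_range_law_moments[OF P i] and mQ = short_range_law_moments[OF Q i]
    note f = integral_pair_fst[OF PS mP(1)] and s = integral_pair_snd[OF PS mQ(1)]
    show "integrable (P \<Otimes>\<^sub>M Q) (\<lambda>z. 8 * ((fst z i) ^ 4 + (snd z i) ^ 4))" using f(1) s(1) by simp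
    show "(LINT z|(P \<Otimes>\<^sub>M Q). 8 * ((fst z i) ^ 4 + (snd z i) ^ 4)) \<le> 16 * U"
      using f s mP(2) mQ(2) by simp
  qed
  have hint: "integrable (P \<Otimes>\<^sub>M Q) (\<lambda>z. (h i z)\<^sup>2)" if i: "i \<in> {1..p}" for i
    by (rule Bochner_Integration.integrable_bound[OF int8[OF i]])
       (use hm[OF i] h2 in \<open>auto simp: abs_of_nonneg intro!: AE_I2\<close>)
  have hbound: "(LINT z|(P \<Otimes>\<^sub>M Q). (h i z)\<^sup>2) \<le> 16 * U" if i: "i \<in> {1..p}" for i
    using integral_mono[OF hint[OF i] int8[OF i] h2] int8'[OF i] by linarith
  have unc: "(LINT z|(P \<Otimes>\<^sub>M Q). h i z * h j z) = (LINT z|(P \<Otimes>\<^sub>M Q). h i z) * (LINT z|(P \<Otimes>\<^sub>M Q). h j z)"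
    if i: "i \<in> {1..p}" and j: "j \<in> {1..p}" and ij: "i + a < j" for i j
  proof -
    define \<phi> where "\<phi> = (\<lambda>i u. (LINT y|Q. (u - y i)\<^sup>2))"
    have iQ: "integrable Q (\<lambda>y. (u - y l)\<^sup>2)" and phi: "\<phi> l u = u\<^sup>2 - 2 * u * (LINT y|Q. y l) + (LINT y|Q. (y l)\<^sup>2)"
      if l: "l \<in> {1..p}" for l u
      using short_range_law_moments(3,4)[OF Q l] by (simp_all add: \<phi>_def power2_diff Q.prob_space)
    have pm: "\<phi> l \<in> borel_measurable borel" if l: "l \<in> {1..p}" for l
      unfolding phi[OF l, abs_def] by measurable
    have pI: "integrable P (\<lambda>x. \<phi> l (x l))" if l: "l \<in> {1..p}" for l
      unfolding phi[OF l] using short_range_law_moments(3,4)[OF P l] by simp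
    have i1: "integrable (P \<Otimes>\<^sub>M Q) (h l)" if "l \<in> {1..p}" for l
      using PQ.square_integrable_imp_integrable[OF hm hint] that by simp
    have e1: "(LINT z|(P \<Otimes>\<^sub>M Q). h l z) = (LINT x|P. \<phi> l (x l))" if "l \<in> {1..p}" for l
      using PQ.integral_fst'[OF i1[OF that]] by (simp add: h_def \<phi>_def)
    have ihh: "integrable (P \<Otimes>\<^sub>M Q) (\<lambda>z. h i z * h j z)"
      using i j by (intro integrable_mult_of_squares hm hint)
    have "(LINT z|(P \<Otimes>\<^sub>M Q). h i z * h j z) = (LINT x|P. LINT y|Q. (x i - y i)\<^sup>2 * (x j - y j)\<^sup>2)"
      using PQ.integral_fst'[OF ihh] by (simp add: h_def)
    also have "\<dots> = (LINT x|P. \<phi> i (x i) * \<phi> j (x j))"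
    proof (intro Bochner_Integration.integral_cong refl)
      fix x
      show "(LINT y|Q. (x i - y i)\<^sup>2 * (x j - y j)\<^sup>2) = \<phi> i (x i) * \<phi> j (x j)"
        unfolding \<phi>_def using i j ij iQ
        by (intro m_dependent_expectation_mult[OF bp(2) dep(2), where \<phi>="\<lambda>v. (x i - v)\<^sup>2" and \<psi>="\<lambda>v. (x j - v)\<^sup>2"]) auto
    qed
    also have "\<dots> = (LINT x|P. \<phi> i (x i)) * (LINT x|P. \<phi> j (x j))"
      using i j ij pI pm by (intro m_dependent_expectation_mult[OF bp(1) dep(1)]) auto
    finally show ?thesis using e1 i j by simp
  qed
  note V = PQ.variance_sum_locally_dependent[of p h "16 * U" a, OF hm hint hbound unc]
  have eq: "(\<Sum>i=1..p. h i z) = (vdist p (fst z) (snd z))\<^sup>2" for z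
    by (simp add: h_def vdist_sq)
  show "integrable (P \<Otimes>\<^sub>M Q) (\<lambda>z. (vdist p (fst z) (snd z))\<^sup>2)"
    using V(1) unfolding eq .
  show "integrable (P \<Otimes>\<^sub>M Q) (\<lambda>z. ((vdist p (fst z) (snd z))\<^sup>2 - mean_sq_dist p P Q)\<^sup>2)"
    using V(2) unfolding eq mean_sq_dist_def .
  show "(LINT z|(P \<Otimes>\<^sub>M Q). ((vdist p (fst z) (snd z))\<^sup>2 - mean_sq_dist p P Q)\<^sup>2)
          \<le> 16 * U * (real p * (2 * real a + 1))"
    using V(3) unfolding eq mean_sq_dist_def .
qed

section \<open>When the test statistic exceeds its threshold\<close>

lemma expectation_double_sum_le:
  fixes g :: "'i \<Rightarrow> 'j \<Rightarrow> 'a \<Rightarrow> real"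
  assumes int: "\<And>i j. \<lbrakk>i \<in> A; j \<in> B i\<rbrakk> \<Longrightarrow> integrable M (g i j)"
    and le: "\<And>i j. \<lbrakk>i \<in> A; j \<in> B i\<rbrakk> \<Longrightarrow> integral\<^sup>L M (g i j) \<le> \<eta>"
  shows "integrable M (\<lambda>\<omega>. \<Sum>i\<in>A. \<Sum>j\<in>B i. g i j \<omega>)"
    and "(LINT \<omega>|M. (\<Sum>i\<in>A. \<Sum>j\<in>B i. g i j \<omega>)) \<le> (\<Sum>i\<in>A. \<Sum>j\<in>B i. \<eta>)"
proof -
  have inner: "integrable M (\<lambda>\<omega>. \<Sum>j\<in>B i. g i j \<omega>)" if "i \<in> A" for i
    using int[OF that] by (intro Bochner_Integration.integrable_sum)
  show "integrable M (\<lambda>\<omega>. \<Sum>i\<in>A. \<Sum>j\<in>B i. g i j \<omega>)"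
    using inner by (rule Bochner_Integration.integrable_sum)
  have "(LINT \<omega>|M. (\<Sum>i\<in>A. \<Sum>j\<in>B i. g i j \<omega>)) = (\<Sum>i\<in>A. LINT \<omega>|M. (\<Sum>j\<in>B i. g i j \<omega>))"
    using inner by (intro Bochner_Integration.integral_sum)
  also have "\<dots> = (\<Sum>i\<in>A. \<Sum>j\<in>B i. integral\<^sup>L M (g i j))"
    using int by (intro sum.cong refl Bochner_Integration.integral_sum)
  also have "\<dots> \<le> (\<Sum>i\<in>A. \<Sum>j\<in>B i. \<eta>)" using le by (intro sum_mono)
  finally show "(LINT \<omega>|M. (\<Sum>i\<in>A. \<Sum>j\<in>B i. g i j \<omega>)) \<le> (\<Sum>i\<in>A. \<Sum>j\<in>B i. \<eta>)" .
qed

lemma c_nm_pos: "\<lbrakk>2 \<le> n; 2 \<le> m\<rbrakk> \<Longrightarrow> 0 < c_nm n m"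
  unfolding c_nm_def by (intro add_pos_pos divide_pos_pos mult_pos_pos) auto

text \<open>The deterministic core. Closeness to the constants \<open>a, b, c\<close> makes the numerator larger than half the
gap \<open>g\<close>. The four extra kernel values rule out that the variance statistic vanishes, since otherwise
\<open>b + c\<close> would be close to \<open>2 a\<close>. This matters because the quotient is 0 for a zero denominator. Finally
the smallness condition bounds the denominator by \<open>g / (2 C)\<close>.\<close>

lemma T_stat_exceeds_if_close:
  assumes n: "2 \<le> n" "2 \<le> m"
    and diag: "\<And>i. 1 \<le> i \<Longrightarrow> k (x i) (x i) = a0" "\<And>j. 1 \<le> j \<Longrightarrow> k (y j) (y j) = a0"
    and sym: "k (y 1) (x 2) = k (x 2) (y 1)"
    and gap: "g \<le> 2 * a - b - c" and pos: "0 < g" "0 < C"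
    and close: "energy_deviation k n m x y a b c + (\<bar>k (x 1) (x 2) - b\<bar> + \<bar>k (y 1) (y 2) - c\<bar>
        + \<bar>k (x 1) (y 2) - a\<bar> + \<bar>k (x 2) (y 1) - a\<bar>) < g / 2"
    and small: "c_nm n m * (400 / (real (n + m))\<^sup>2 *
        (\<Sum>s=1..n + m. \<Sum>t=1..n + m. (k (pooled n x y s) (pooled n x y t))\<^sup>2)) < (g / (2 * C))\<^sup>2"
  shows "C < T_stat k a0 n m x y"
proof -
  define V where "V = variance_stat k a0 n m x y"
  define E where "E = energy_stat k n m x y"
  have N: "4 \<le> n + m" using n by simp
  have dg: "k (pooled n x y s) (pooled n x y s) = a0" if "s \<in> {1..n + m}" for s
    using that diag by (auto simp: pooled_def)
  have c: "0 < c_nm n m" using n by (rule c_nm_pos)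
  have dev: "\<bar>E - (2 * a - b - c)\<bar> \<le> energy_deviation k n m x y a b c"
    unfolding E_def using n by (rule energy_stat_diff)
  then have E: "g / 2 < E" using close gap by linarith
  have "V \<noteq> 0"
  proof
    assume "V = 0"
    from variance_stat_zero_imp_additive[of n m k x y a0, OF n dg this[unfolded V_def]] sym
    have "k (x 1) (x 2) + k (y 1) (y 2) = k (x 1) (y 2) + k (x 2) (y 1)" by simp
    then show False using close gap dev pos by linarith
  qed
  moreover have "0 \<le> V" unfolding V_def using N dg by (rule variance_stat_nonneg)
  ultimately have cV: "0 < c_nm n m * V" using c by simp
  have "c_nm n m * V \<le> c_nm n m * (400 / (real (n + m))\<^sup>2 *
        (\<Sum>s=1..n + m. \<Sum>t=1..n + m. (k (pooled n x y s) (pooled n x y t))\<^sup>2))"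
    unfolding V_def using variance_stat_upper[OF N] c by (intro mult_left_mono) auto
  also note small
  finally have "sqrt (c_nm n m * V) < g / (2 * C)"
    using pos by (intro real_less_lsqrt) auto
  then have "C * sqrt (c_nm n m * V) < g / 2"
    using pos by (simp add: field_simps)
  also note E
  finally show ?thesis
    unfolding T_stat_def E_def[symmetric] V_def[symmetric] using cV by (simp add: pos_less_divide_eq)
qed

lemma T_stat_measurable:
  fixes X Y :: "nat \<Rightarrow> 'a \<Rightarrow> vec"
  assumes meas: "\<And>u v. \<lbrakk>u \<in> {1..} <+> {1..}; v \<in> {1..} <+> {1..}\<rbrakk> \<Longrightarrow>
      (\<lambda>\<omega>. k (case_sum X Y u \<omega>) (case_sum X Y v \<omega>)) \<in> borel_measurable M"
  shows "(\<lambda>\<omega>. T_stat k a0 n m (\<lambda>i. X i \<omega>) (\<lambda>j. Y j \<omega>)) \<in> borel_measurable M"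
proof -
  have XX: "(\<lambda>\<omega>. k (X i \<omega>) (X j \<omega>)) \<in> borel_measurable M" if "1 \<le> i" "1 \<le> j" for i j
    using meas[of "Inl i" "Inl j"] that by (simp add: InlI)
  have XY: "(\<lambda>\<omega>. k (X i \<omega>) (Y j \<omega>)) \<in> borel_measurable M" if "1 \<le> i" "1 \<le> j" for i j
    using meas[of "Inl i" "Inr j"] that by (simp add: InlI InrI)
  have YX: "(\<lambda>\<omega>. k (Y i \<omega>) (X j \<omega>)) \<in> borel_measurable M" if "1 \<le> i" "1 \<le> j" for i j
    using meas[of "Inr i" "Inl j"] that by (simp add: InlI InrI)
  have YY: "(\<lambda>\<omega>. k (Y i \<omega>) (Y j \<omega>)) \<in> borel_measurable M" if "1 \<le> i" "1 \<le> j" for i j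
    using meas[of "Inr i" "Inr j"] that by (simp add: InrI)
  have pool: "(\<lambda>\<omega>. k (pooled n (\<lambda>i. X i \<omega>) (\<lambda>j. Y j \<omega>) s) (pooled n (\<lambda>i. X i \<omega>) (\<lambda>j. Y j \<omega>) t))
      \<in> borel_measurable M" if "1 \<le> s" "1 \<le> t" for s t
    using XX[of s t] XY[of s "t - n"] YX[of "s - n" t] YY[of "s - n" "t - n"] that
    by (cases "s \<le> n"; cases "t \<le> n") (simp_all add: pooled_def)
  have cen: "(\<lambda>\<omega>. centred (n + m) (\<lambda>s t. k (pooled n (\<lambda>i. X i \<omega>) (\<lambda>j. Y j \<omega>) s)
      (pooled n (\<lambda>i. X i \<omega>) (\<lambda>j. Y j \<omega>) t)) s t) \<in> borel_measurable M" if "1 \<le> s" "1 \<le> t" for s t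
    unfolding centred_def
    by (intro borel_measurable_add borel_measurable_diff borel_measurable_divide
          borel_measurable_sum borel_measurable_const pool) (use that in auto)
  have V: "(\<lambda>\<omega>. variance_stat k a0 n m (\<lambda>i. X i \<omega>) (\<lambda>j. Y j \<omega>)) \<in> borel_measurable M"
    unfolding variance_stat_def Let_def
    by (intro borel_measurable_diff borel_measurable_divide borel_measurable_power
          borel_measurable_sum borel_measurable_const cen) auto
  have E: "(\<lambda>\<omega>. energy_stat k n m (\<lambda>i. X i \<omega>) (\<lambda>j. Y j \<omega>)) \<in> borel_measurable M"
    unfolding energy_stat_def
    by (intro borel_measurable_diff borel_measurable_divide borel_measurable_times
          borel_measurable_sum borel_measurable_const XX XY YY) auto
  show ?thesis
    unfolding T_stat_def using E V by measurable
qed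

text \<open>Markov's inequality, applied to the two smallness conditions of \<open>T_stat_exceeds_if_close\<close>: the averages and single
values that measure closeness have total expectation at most \<open>8 \<eta>\<close>, and the mean square of the kernel matrix has
expectation at most \<open>\<kappa>\<close>.\<close>

lemma (in prob_space) T_stat_exceeds_prob:
  fixes X Y :: "nat \<Rightarrow> 'a \<Rightarrow> vec"
  defines "Z \<equiv> case_sum X Y" and "I \<equiv> {1..} <+> {1..}"
  assumes n: "2 \<le> n" "2 \<le> m"
    and meas: "\<And>u v. \<lbrakk>u \<in> I; v \<in> I\<rbrakk> \<Longrightarrow> (\<lambda>\<omega>. k (Z u \<omega>) (Z v \<omega>)) \<in> borel_measurable M"
    and diag: "\<And>u \<omega>. \<lbrakk>u \<in> I; \<omega> \<in> space M\<rbrakk> \<Longrightarrow> k (Z u \<omega>) (Z u \<omega>) = a0"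
    and sym: "\<And>u v \<omega>. \<lbrakk>u \<in> I; v \<in> I; \<omega> \<in> space M\<rbrakk> \<Longrightarrow> k (Z u \<omega>) (Z v \<omega>) = k (Z v \<omega>) (Z u \<omega>)"
    and sq: "\<And>u v. \<lbrakk>u \<in> I; v \<in> I\<rbrakk> \<Longrightarrow> integrable M (\<lambda>\<omega>. (k (Z u \<omega>) (Z v \<omega>))\<^sup>2)"
      "\<And>u v. \<lbrakk>u \<in> I; v \<in> I\<rbrakk> \<Longrightarrow> expectation (\<lambda>\<omega>. (k (Z u \<omega>) (Z v \<omega>))\<^sup>2) \<le> \<kappa>"
    and devXY: "\<And>i j. \<lbrakk>1 \<le> i; 1 \<le> j\<rbrakk> \<Longrightarrow> expectation (\<lambda>\<omega>. \<bar>k (X i \<omega>) (Y j \<omega>) - a\<bar>) \<le> \<eta>"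
    and devXX: "\<And>i j. \<lbrakk>1 \<le> i; i < j\<rbrakk> \<Longrightarrow> expectation (\<lambda>\<omega>. \<bar>k (X i \<omega>) (X j \<omega>) - b\<bar>) \<le> \<eta>"
    and devYY: "\<And>i j. \<lbrakk>1 \<le> i; i < j\<rbrakk> \<Longrightarrow> expectation (\<lambda>\<omega>. \<bar>k (Y i \<omega>) (Y j \<omega>) - c\<bar>) \<le> \<eta>"
    and gap: "g \<le> 2 * a - b - c" and pos: "0 < g" "0 < C"
  shows "1 - 16 * \<eta> / g - 1600 * \<kappa> * C\<^sup>2 * c_nm n m / g\<^sup>2
     \<le> prob {\<omega> \<in> space M. C < T_stat k a0 n m (\<lambda>i. X i \<omega>) (\<lambda>j. Y j \<omega>)}"
proof -
  define N where "N = n + m"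
  have N: "4 \<le> N" "0 < real N" using n by (auto simp: N_def)
  have c: "0 < c_nm n m" using n by (rule c_nm_pos)
  define idx where "idx = (\<lambda>s. if s \<le> n then Inl s else Inr (s - n) :: nat + nat)"
  have idx: "idx s \<in> I" if "s \<in> {1..N}" for s
    using that by (auto simp: idx_def I_def)
  have pool: "pooled n (\<lambda>i. X i \<omega>) (\<lambda>j. Y j \<omega>) s = Z (idx s) \<omega>" for s \<omega>
    by (simp add: pooled_def idx_def Z_def)
  have kint: "integrable M (\<lambda>\<omega>. k (Z u \<omega>) (Z v \<omega>))" if "u \<in> I" "v \<in> I" for u v
    using square_integrable_imp_integrable[OF meas sq(1)] that by blast
  have iXY: "integrable M (\<lambda>\<omega>. \<bar>k (X i \<omega>) (Y j \<omega>) - r\<bar>)" if "1 \<le> i" "1 \<le> j" for i j r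
    using kint[of "Inl i" "Inr j"] that by (simp add: Z_def I_def InlI InrI)
  have iXX: "integrable M (\<lambda>\<omega>. \<bar>k (X i \<omega>) (X j \<omega>) - r\<bar>)" if "1 \<le> i" "1 \<le> j" for i j r
    using kint[of "Inl i" "Inl j"] that by (simp add: Z_def I_def InlI InrI)
  have iYY: "integrable M (\<lambda>\<omega>. \<bar>k (Y i \<omega>) (Y j \<omega>) - r\<bar>)" if "1 \<le> i" "1 \<le> j" for i j r
    using kint[of "Inr i" "Inr j"] that by (simp add: Z_def I_def InlI InrI)
  define R1 where "R1 = (\<lambda>\<omega>. \<Sum>i=1..n. \<Sum>j=1..m. \<bar>k (X i \<omega>) (Y j \<omega>) - a\<bar>)"
  define R2 where "R2 = (\<lambda>\<omega>. \<Sum>j=1..n. \<Sum>i=1..<j. \<bar>k (X i \<omega>) (X j \<omega>) - b\<bar>)"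
  define R3 where "R3 = (\<lambda>\<omega>. \<Sum>j=1..m. \<Sum>i=1..<j. \<bar>k (Y i \<omega>) (Y j \<omega>) - c\<bar>)"
  have R1: "integrable M R1" "expectation R1 \<le> (\<Sum>i=1..n. \<Sum>j=1..m. \<eta>)"
  proof -
    have 1: "integrable M (\<lambda>\<omega>. \<bar>k (X i \<omega>) (Y j \<omega>) - a\<bar>)" if "i \<in> {1..n}" "j \<in> {1..m}" for i j
      using iXY that by auto
    have 2: "expectation (\<lambda>\<omega>. \<bar>k (X i \<omega>) (Y j \<omega>) - a\<bar>) \<le> \<eta>" if "i \<in> {1..n}" "j \<in> {1..m}" for i j
      using devXY that by auto
    note * = expectation_double_sum_le[where A="{1..n}" and B="\<lambda>_. {1..m}", OF 1 2]
    show "integrable M R1" unfolding R1_def by (rule *)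
    show "expectation R1 \<le> (\<Sum>i=1..n. \<Sum>j=1..m. \<eta>)" unfolding R1_def by (rule *)
  qed
  have R2: "integrable M R2" "expectation R2 \<le> (\<Sum>j=1..n. \<Sum>i=1..<j. \<eta>)"
  proof -
    have 1: "integrable M (\<lambda>\<omega>. \<bar>k (X i \<omega>) (X j \<omega>) - b\<bar>)" if "j \<in> {1..n}" "i \<in> {1..<j}" for j i
      using iXX that by auto
    have 2: "expectation (\<lambda>\<omega>. \<bar>k (X i \<omega>) (X j \<omega>) - b\<bar>) \<le> \<eta>" if "j \<in> {1..n}" "i \<in> {1..<j}" for j i
      using devXX that by auto
    note * = expectation_double_sum_le[where A="{1..n}" and B="\<lambda>j. {1..<j}", OF 1 2]
    show "integrable M R2" unfolding R2_def by (rule *)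
    show "expectation R2 \<le> (\<Sum>j=1..n. \<Sum>i=1..<j. \<eta>)" unfolding R2_def by (rule *)
  qed
  have R3: "integrable M R3" "expectation R3 \<le> (\<Sum>j=1..m. \<Sum>i=1..<j. \<eta>)"
  proof -
    have 1: "integrable M (\<lambda>\<omega>. \<bar>k (Y i \<omega>) (Y j \<omega>) - c\<bar>)" if "j \<in> {1..m}" "i \<in> {1..<j}" for j i
      using iYY that by auto
    have 2: "expectation (\<lambda>\<omega>. \<bar>k (Y i \<omega>) (Y j \<omega>) - c\<bar>) \<le> \<eta>" if "j \<in> {1..m}" "i \<in> {1..<j}" for j i
      using devYY that by auto
    note * = expectation_double_sum_le[where A="{1..m}" and B="\<lambda>j. {1..<j}", OF 1 2]
    show "integrable M R3" unfolding R3_def by (rule *)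
    show "expectation R3 \<le> (\<Sum>j=1..m. \<Sum>i=1..<j. \<eta>)" unfolding R3_def by (rule *)
  qed
  have bin: "0 < real (n choose 2)" "0 < real (m choose 2)"
    using n by (auto simp: zero_less_binomial_iff)
  define D where "D = (\<lambda>\<omega>. energy_deviation k n m (\<lambda>i. X i \<omega>) (\<lambda>j. Y j \<omega>) a b c)"
  have D_eq: "D = (\<lambda>\<omega>. 2 / (real n * real m) * R1 \<omega> + R2 \<omega> / real (n choose 2) + R3 \<omega> / real (m choose 2))"
    by (simp add: D_def energy_deviation_def R1_def R2_def R3_def)
  have D: "integrable M D" "expectation D \<le> 4 * \<eta>"
  proof -
    show "integrable M D" unfolding D_eq using R1 R2 R3 by simp
    have "expectation D = 2 / (real n * real m) * expectation R1
        + expectation R2 / real (n choose 2) + expectation R3 / real (m choose 2)"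
      unfolding D_eq using R1 R2 R3 by simp
    also have "\<dots> \<le> 2 / (real n * real m) * (\<Sum>i=1..n. \<Sum>j=1..m. \<eta>)
        + (\<Sum>j=1..n. \<Sum>i=1..<j. \<eta>) / real (n choose 2) + (\<Sum>j=1..m. \<Sum>i=1..<j. \<eta>) / real (m choose 2)"
      using R1 R2 R3 by (intro add_mono mult_left_mono divide_right_mono) auto
    also have "\<dots> = 4 * \<eta>"
      using n bin unfolding sum_pairs_const by simp
    finally show "expectation D \<le> 4 * \<eta>" .
  qed
  define F where "F = (\<lambda>\<omega>. \<bar>k (X 1 \<omega>) (X 2 \<omega>) - b\<bar> + \<bar>k (Y 1 \<omega>) (Y 2 \<omega>) - c\<bar>
        + \<bar>k (X 1 \<omega>) (Y 2 \<omega>) - a\<bar> + \<bar>k (X 2 \<omega>) (Y 1 \<omega>) - a\<bar>)"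
  have F: "integrable M F" "expectation F \<le> 4 * \<eta>"
    using devXX[of 1 2] devYY[of 1 2] devXY[of 1 2] devXY[of 2 1]
      iXX[of 1 2 b] iYY[of 1 2 c] iXY[of 1 2 a] iXY[of 2 1 a]
    unfolding F_def by simp_all
  define S where "S = (\<lambda>\<omega>. \<Sum>s=1..N. \<Sum>t=1..N. (k (Z (idx s) \<omega>) (Z (idx t) \<omega>))\<^sup>2)"
  have S: "integrable M S" "expectation S \<le> (\<Sum>s=1..N. \<Sum>t=1..N. \<kappa>)"
  proof -
    have 1: "integrable M (\<lambda>\<omega>. (k (Z (idx s) \<omega>) (Z (idx t) \<omega>))\<^sup>2)" if "s \<in> {1..N}" "t \<in> {1..N}" for s t
      using sq(1) idx that by auto
    have 2: "expectation (\<lambda>\<omega>. (k (Z (idx s) \<omega>) (Z (idx t) \<omega>))\<^sup>2) \<le> \<kappa>" if "s \<in> {1..N}" "t \<in> {1..N}" for s t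
      using sq(2) idx that by auto
    note * = expectation_double_sum_le[where A="{1..N}" and B="\<lambda>_. {1..N}", OF 1 2]
    show "integrable M S" unfolding S_def by (rule *)
    show "expectation S \<le> (\<Sum>s=1..N. \<Sum>t=1..N. \<kappa>)" unfolding S_def by (rule *)
  qed
  define bad1 where "bad1 = {\<omega> \<in> space M. D \<omega> + F \<omega> \<ge> g / 2}"
  define bad2 where "bad2 = {\<omega> \<in> space M. S \<omega> \<ge> (g / (2 * C))\<^sup>2 * (real N)\<^sup>2 / (400 * c_nm n m)}"
  have [measurable]: "D \<in> borel_measurable M" "F \<in> borel_measurable M" "S \<in> borel_measurable M"
    using D F S by auto
  have bads: "bad1 \<in> events" "bad2 \<in> events" by (simp_all add: bad1_def bad2_def)
  have nonneg: "0 \<le> D \<omega>" "0 \<le> F \<omega>" "0 \<le> S \<omega>" for \<omega>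
    by (auto simp: D_def energy_deviation_def F_def S_def intro!: sum_nonneg add_nonneg_nonneg divide_nonneg_nonneg)
  have "prob bad1 \<le> expectation (\<lambda>\<omega>. D \<omega> + F \<omega>) / (g / 2)"
    unfolding bad1_def using D F nonneg pos
    by (intro integral_Markov_inequality_measure[where A="{}"]) auto
  also have "\<dots> \<le> 8 * \<eta> / (g / 2)" using D F pos by (intro divide_right_mono) auto
  finally have p1: "prob bad1 \<le> 16 * \<eta> / g" by simp
  have "prob bad2 \<le> expectation S / ((g / (2 * C))\<^sup>2 * (real N)\<^sup>2 / (400 * c_nm n m))"
    unfolding bad2_def using S nonneg pos c N
    by (intro integral_Markov_inequality_measure[where A="{}"]) auto
  also have "\<dots> \<le> (real N)\<^sup>2 * \<kappa> / ((g / (2 * C))\<^sup>2 * (real N)\<^sup>2 / (400 * c_nm n m))"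
    using S pos c N by (intro divide_right_mono) (auto simp: power2_eq_square)
  also have "\<dots> = 1600 * \<kappa> * C\<^sup>2 * c_nm n m / g\<^sup>2"
    using N pos c by (simp add: power_divide power_mult_distrib field_simps)
  finally have p2: "prob bad2 \<le> 1600 * \<kappa> * C\<^sup>2 * c_nm n m / g\<^sup>2" .
  let ?T = "{\<omega> \<in> space M. C < T_stat k a0 n m (\<lambda>i. X i \<omega>) (\<lambda>j. Y j \<omega>)}"
  \<comment> \<open>The threshold in \<open>bad2\<close> is the smallness condition on the denominator, solved for \<open>S\<close>.\<close>
  have "space M - (bad1 \<union> bad2) \<subseteq> ?T"
  proof (safe, rule T_stat_exceeds_if_close[OF n])
    fix \<omega> assume w: "\<omega> \<in> space M" "\<omega> \<notin> bad1" "\<omega> \<notin> bad2"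
    show "k (X i \<omega>) (X i \<omega>) = a0" "k (Y i \<omega>) (Y i \<omega>) = a0" if "1 \<le> i" for i
      using diag[of "Inl i" \<omega>] diag[of "Inr i" \<omega>] w that by (simp_all add: Z_def I_def InlI InrI)
    show "k (Y 1 \<omega>) (X 2 \<omega>) = k (X 2 \<omega>) (Y 1 \<omega>)"
      using sym[of "Inr 1" "Inl 2" \<omega>] w by (simp add: Z_def I_def InlI InrI)
    show "energy_deviation k n m (\<lambda>i. X i \<omega>) (\<lambda>j. Y j \<omega>) a b c + (\<bar>k (X 1 \<omega>) (X 2 \<omega>) - b\<bar> + \<bar>k (Y 1 \<omega>) (Y 2 \<omega>) - c\<bar>
        + \<bar>k (X 1 \<omega>) (Y 2 \<omega>) - a\<bar> + \<bar>k (X 2 \<omega>) (Y 1 \<omega>) - a\<bar>) < g / 2"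
      using w by (simp add: bad1_def D_def F_def)
    have "S \<omega> < (g / (2 * C))\<^sup>2 * (real N)\<^sup>2 / (400 * c_nm n m)" using w by (simp add: bad2_def)
    then have "S \<omega> * (400 * c_nm n m) < (g / (2 * C))\<^sup>2 * (real N)\<^sup>2"
      using c by (subst (asm) pos_less_divide_eq) auto
    then have "S \<omega> * (400 * c_nm n m) / (real N)\<^sup>2 < (g / (2 * C))\<^sup>2"
      using N by (subst pos_divide_less_eq) auto
    then have "c_nm n m * (400 / (real N)\<^sup>2 * S \<omega>) < (g / (2 * C))\<^sup>2"
      by (simp add: ac_simps)
    then show "c_nm n m * (400 / (real (n + m))\<^sup>2 *
        (\<Sum>s=1..n + m. \<Sum>t=1..n + m. (k (pooled n (\<lambda>i. X i \<omega>) (\<lambda>j. Y j \<omega>) s)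
          (pooled n (\<lambda>i. X i \<omega>) (\<lambda>j. Y j \<omega>) t))\<^sup>2)) < (g / (2 * C))\<^sup>2"
      unfolding pool by (simp add: S_def N_def)
  qed (use gap pos in auto)
  moreover have "?T \<in> events"
    using T_stat_measurable[of k X Y M a0 n m] meas by (simp add: Z_def I_def)
  ultimately have "prob (space M - (bad1 \<union> bad2)) \<le> prob ?T" by (intro finite_measure_mono)
  moreover have "prob (space M - (bad1 \<union> bad2)) = 1 - prob (bad1 \<union> bad2)"
    using bads by (intro prob_compl) auto
  moreover have "prob (bad1 \<union> bad2) \<le> prob bad1 + prob bad2"
    using bads by (intro measure_Un_le)
  ultimately show ?thesis using p1 p2 by linarith
qed

section \<open>Reproducing kernels\<close>

text \<open>By the reproducing property the quadratic form is the squared norm of the function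
\<open>\<Sum>i\<in>J. c i * K x (z i)\<close>, which is built inside the Hilbert space by induction on the index set.\<close>

lemma rkhs_positive_semidefinite:
  fixes K :: "'b \<Rightarrow> 'b \<Rightarrow> real" and c :: "'i \<Rightarrow> real"
  assumes rk: "rkhs S H ip K" and J: "finite J" and z: "\<And>i. i \<in> J \<Longrightarrow> z i \<in> S"
  shows "0 \<le> (\<Sum>i\<in>J. \<Sum>j\<in>J. c i * c j * K (z i) (z j))"
proof -
  have zero: "(\<lambda>x\<in>S. 0) \<in> H"
    using rk by (auto simp: rkhs_def hilbert_function_space_def)
  have plus: "(\<lambda>x\<in>S. g x + h x) \<in> H" if "g \<in> H" "h \<in> H" for g h
    using rk that by (auto simp: rkhs_def hilbert_function_space_def)
  have scale: "(\<lambda>x\<in>S. r * g x) \<in> H" if "g \<in> H" for r g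
    using rk that by (auto simp: rkhs_def hilbert_function_space_def)
  have sym: "ip g h = ip h g" if "g \<in> H" "h \<in> H" for g h
    using rk that by (auto simp: rkhs_def hilbert_function_space_def)
  have ip_plus: "ip (\<lambda>x\<in>S. g x + h x) u = ip g u + ip h u" if "g \<in> H" "h \<in> H" "u \<in> H" for g h u
    using rk that by (auto simp: rkhs_def hilbert_function_space_def)
  have ip_scale: "ip (\<lambda>x\<in>S. r * g x) u = r * ip g u" if "g \<in> H" "u \<in> H" for r g u
    using rk that by (auto simp: rkhs_def hilbert_function_space_def)
  have pos: "0 \<le> ip g g" if "g \<in> H" for g
    using rk that by (auto simp: rkhs_def hilbert_function_space_def)
  have KH: "(\<lambda>y\<in>S. K y x) \<in> H" and rep: "\<And>g. g \<in> H \<Longrightarrow> ip g (\<lambda>y\<in>S. K y x) = g x" if "x \<in> S" for x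
    using rk that by (auto simp: rkhs_def)
  have "\<exists>h\<in>H. (\<forall>g\<in>H. ip g h = (\<Sum>i\<in>J. c i * g (z i))) \<and> (\<forall>x\<in>S. h x = (\<Sum>i\<in>J. c i * K x (z i)))"
    using J z
  proof (induction J)
    case empty
    have ip0: "ip g (\<lambda>x\<in>S. 0) = 0" if "g \<in> H" for g
      using ip_scale[OF zero that, where r=0] sym[OF that zero] by simp
    show ?case
    proof (rule bexI[OF _ zero], intro conjI ballI)
      show "ip g (\<lambda>x\<in>S. 0) = (\<Sum>i\<in>{}. c i * g (z i))" if "g \<in> H" for g
        using ip0[OF that] by (simp only: sum.empty)
    qed simp
  next
    case (insert i J)
    then obtain h where h: "h \<in> H" "\<And>g. g \<in> H \<Longrightarrow> ip g h = (\<Sum>i\<in>J. c i * g (z i))"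
      "\<And>x. x \<in> S \<Longrightarrow> h x = (\<Sum>i\<in>J. c i * K x (z i))" by auto
    have zi: "z i \<in> S" using insert.prems by simp
    define e where "e = (\<lambda>x\<in>S. c i * (\<lambda>y\<in>S. K y (z i)) x)"
    have e: "e \<in> H" unfolding e_def by (rule scale[OF KH[OF zi]])
    define h' where "h' = (\<lambda>x\<in>S. h x + e x)"
    have h': "h' \<in> H" unfolding h'_def by (rule plus[OF h(1) e])
    have "ip g h' = (\<Sum>i\<in>insert i J. c i * g (z i))" if g: "g \<in> H" for g
    proof -
      have "ip e g = c i * g (z i)"
        unfolding e_def using ip_scale[OF KH[OF zi] g] sym[OF KH[OF zi] g] rep[OF zi g] by simp
      then have "ip h' g = ip g h + c i * g (z i)"
        unfolding h'_def using ip_plus[OF h(1) e g] sym[OF h(1) g] by simp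
      then show ?thesis using h(2)[OF g] sym[OF h' g] insert.hyps by simp
    qed
    moreover have "h' x = (\<Sum>i\<in>insert i J. c i * K x (z i))" if "x \<in> S" for x
      using that h(3)[OF that] insert.hyps by (simp add: h'_def e_def)
    ultimately show ?case using h' by blast
  qed
  then obtain h where h: "h \<in> H" "\<And>g. g \<in> H \<Longrightarrow> ip g h = (\<Sum>i\<in>J. c i * g (z i))"
      "\<And>x. x \<in> S \<Longrightarrow> h x = (\<Sum>i\<in>J. c i * K x (z i))" by auto
  have "ip h h = (\<Sum>i\<in>J. c i * (\<Sum>j\<in>J. c j * K (z i) (z j)))"
    unfolding h(2)[OF h(1)] using h(3) z by (intro sum.cong refl) simp
  also have "\<dots> = (\<Sum>i\<in>J. \<Sum>j\<in>J. c i * c j * K (z i) (z j))"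
    by (simp add: sum_distrib_left ac_simps)
  finally show ?thesis using pos[OF h(1)] by simp
qed

text \<open>If the reproducing kernel is zero, the reproducing property forces the Hilbert space to be trivial, so
that the zero function is the mean embedding of every probability measure.\<close>

lemma rkhs_zero_not_characteristic:
  assumes ch: "characteristic_reproducing_kernel p K"
    and zero: "\<And>x y. \<lbrakk>x \<in> space (Rp p); y \<in> space (Rp p)\<rbrakk> \<Longrightarrow> K x y = 0"
    and PQ: "borel_prob p P" "borel_prob p Q"
  shows "P = Q"
proof -
  obtain H ip where rk: "rkhs (space (Rp p)) H ip K"
    and inj: "\<And>P Q h. \<lbrakk>borel_prob p P; borel_prob p Q; is_mean_embedding H ip P h; is_mean_embedding H ip Q h\<rbrakk> \<Longrightarrow> P = Q"
    using ch by (auto simp: characteristic_reproducing_kernel_def)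
  let ?S = "space (Rp p)" and ?o = "\<lambda>x\<in>space (Rp p). 0::real"
  have o: "?o \<in> H" using rk by (auto simp: rkhs_def hilbert_function_space_def)
  have ip0: "ip g ?o = 0" if g: "g \<in> H" for g
  proof -
    have "ip (\<lambda>x\<in>?S. 0 * ?o x) g = 0 * ip ?o g" "ip g ?o = ip ?o g"
      using rk o g unfolding rkhs_def hilbert_function_space_def by blast+
    then show ?thesis by simp
  qed
  have g0: "g x = 0" if "g \<in> H" "x \<in> ?S" for g x
  proof -
    have "ip g (\<lambda>y\<in>?S. K y x) = g x" using rk that by (auto simp: rkhs_def)
    moreover have "(\<lambda>y\<in>?S. K y x) = ?o" using zero that by (intro restrict_ext) auto
    ultimately show ?thesis using ip0[OF that(1)] by simp
  qed
  have "is_mean_embedding H ip P ?o" if P: "borel_prob p P" for P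
  proof -
    have sp: "space P = ?S" using P by (auto simp: borel_prob_def dest: sets_eq_imp_space_eq)
    have "integrable P g \<and> (LINT z|P. g z) = 0" if "g \<in> H" for g
      using g0[OF that] Bochner_Integration.integrable_cong[of P P g "\<lambda>_. 0"]
        Bochner_Integration.integral_cong[of P P g "\<lambda>_. 0"] by (simp add: sp)
    then show ?thesis using o ip0 by (simp add: is_mean_embedding_def)
  qed
  with inj PQ show ?thesis by blast
qed

section \<open>Kernel values at the sample points\<close>

lemma (in prob_space) expectation_abs_le_sqrt:
  fixes h :: "'a \<Rightarrow> real"
  assumes m: "h \<in> borel_measurable M" and i: "integrable M (\<lambda>x. (h x)\<^sup>2)" and b: "expectation (\<lambda>x. (h x)\<^sup>2) \<le> B"
  shows "expectation (\<lambda>x. \<bar>h x\<bar>) \<le> sqrt B"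
proof -
  have 1: "integrable M (\<lambda>x. \<bar>h x\<bar>)" using square_integrable_imp_integrable[OF m i] by simp
  have "0 \<le> expectation (\<lambda>x. \<bar>h x\<bar>\<^sup>2) - (expectation (\<lambda>x. \<bar>h x\<bar>))\<^sup>2"
    using variance_eq[OF 1] i variance_positive[of "\<lambda>x. \<bar>h x\<bar>"] by simp
  then have "(expectation (\<lambda>x. \<bar>h x\<bar>))\<^sup>2 \<le> B" using b by simp
  then show ?thesis by (rule real_le_rsqrt)
qed

text \<open>Two samples in a fixed dimension \<open>p\<close>, and a radial kernel whose profile \<open>g\<close> is Lipschitz. The bound \<open>U\<close>
is on fourth moments of coordinates, \<open>L\<close> and \<open>U'\<close> are on mean squared distances per coordinate. All
bounds derived from them are explicit, because they have to be uniform in \<open>p\<close>. The two samples are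
treated as one family \<open>Z\<close> indexed by a disjoint sum, as in the independence assumption.\<close>

locale radial_two_samples =
  fixes p a :: nat and U L U' \<Lambda> :: real and \<Omega> :: "'a measure" and P Q :: "vec measure"
    and X Y :: "nat \<Rightarrow> 'a \<Rightarrow> vec" and k :: kern and g :: "real \<Rightarrow> real"
  assumes p: "1 \<le> p"
    and lawP: "short_range_law p a U P" and lawQ: "short_range_law p a U Q"
    and samples: "two_samples p \<Omega> P Q X Y"
    and kernel: "kernel_on p k"
    and radial: "\<And>x y. \<lbrakk>x \<in> space (Rp p); y \<in> space (Rp p)\<rbrakk> \<Longrightarrow> k x y = g (vdist p x y)"
    and lipschitz: "\<And>u v. \<lbrakk>0 \<le> u; 0 \<le> v\<rbrakk> \<Longrightarrow> \<bar>g u - g v\<bar> \<le> \<Lambda> * \<bar>u - v\<bar>"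
    and L: "0 < L"
    and lower: "L * real p \<le> mean_sq_dist p P P" "L * real p \<le> mean_sq_dist p P Q" "L * real p \<le> mean_sq_dist p Q Q"
    and upper: "mean_sq_dist p P P \<le> U' * real p" "mean_sq_dist p P Q \<le> U' * real p" "mean_sq_dist p Q Q \<le> U' * real p"
begin

definition \<eta> :: real where "\<eta> = \<Lambda> * sqrt (16 * U * (2 * real a + 1) / L)"
definition \<kappa> :: real where "\<kappa> = 2 * (g 0)\<^sup>2 + 2 * \<Lambda>\<^sup>2 * (U' * real p)"
definition Z :: "nat + nat \<Rightarrow> 'a \<Rightarrow> vec" where "Z = case_sum X Y"
definition I :: "(nat + nat) set" where "I = {1..} <+> {1..}"
definition law :: "nat + nat \<Rightarrow> vec measure" where "law = case_sum (\<lambda>_. P) (\<lambda>_. Q)"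

lemma \<Lambda>_nonneg: "0 \<le> \<Lambda>"
  using lipschitz[of 1 0] by simp

lemma borel_probs: "borel_prob p P" "borel_prob p Q"
  using lawP lawQ by (auto simp: short_range_law_def)

lemma prob_spaces: "prob_space P" "prob_space Q"
  and sets_eq: "sets P = sets (Rp p)" "sets Q = sets (Rp p)"
  using borel_probs by (auto simp: borel_prob_def)

lemma space_eq: "space P = space (Rp p)" "space Q = space (Rp p)"
  using sets_eq by (auto dest: sets_eq_imp_space_eq)

lemma kernel_measurable: "(\<lambda>z. k (fst z) (snd z)) \<in> borel_measurable (Rp p \<Otimes>\<^sub>M Rp p)"
  using kernel by (simp add: kernel_on_def case_prod_beta')

lemma kernel_symmetric: "\<lbrakk>x \<in> space (Rp p); y \<in> space (Rp p)\<rbrakk> \<Longrightarrow> k x y = k y x"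
  using kernel by (simp add: kernel_on_def)

text \<open>Write \<open>d\<close> for the distance, \<open>s\<close> for the root of its mean square \<open>A\<close>. Then
\<open>(d - s)\<^sup>2 A \<le> (d - s)\<^sup>2 (d + s)\<^sup>2 = (d\<^sup>2 - A)\<^sup>2\<close>, and the right-hand side has expectation at most of
order \<open>p\<close>. As \<open>A\<close> is at least of order \<open>p\<close>, \<open>d\<close> stays within bounded mean distance of \<open>s\<close>, and the Lipschitz condition
carries this over to the kernel.\<close>

lemma kernel_moments:
  assumes R: "short_range_law p a U R" "short_range_law p a U S"
    and lo: "L * real p \<le> mean_sq_dist p R S" and up: "mean_sq_dist p R S \<le> U' * real p"
  shows "integrable (R \<Otimes>\<^sub>M S) (\<lambda>z. (k (fst z) (snd z))\<^sup>2)"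
    and "(LINT z|(R \<Otimes>\<^sub>M S). (k (fst z) (snd z))\<^sup>2) \<le> \<kappa>"
    and "integrable (R \<Otimes>\<^sub>M S) (\<lambda>z. k (fst z) (snd z))"
    and "(LINT z|(R \<Otimes>\<^sub>M S). \<bar>k (fst z) (snd z) - g (A0 p R S)\<bar>) \<le> \<eta>"
    and "\<bar>kint k R S - g (A0 p R S)\<bar> \<le> \<eta>"
proof -
  have bp: "borel_prob p R" "borel_prob p S" using R by (auto simp: short_range_law_def)
  have sets: "sets R = sets (Rp p)" "sets S = sets (Rp p)" using bp by (auto simp: borel_prob_def)
  then have sp: "space R = space (Rp p)" "space S = space (Rp p)" by (auto dest: sets_eq_imp_space_eq)
  interpret R: prob_space R using bp by (simp add: borel_prob_def)
  interpret S: prob_space S using bp by (simp add: borel_prob_def)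
  interpret RS: pair_prob_space R S ..
  define A where "A = mean_sq_dist p R S"
  define s where "s = A0 p R S"
  define d :: "vec \<times> vec \<Rightarrow> real" where "d = (\<lambda>z. vdist p (fst z) (snd z))"
  note conc = squared_distance_concentration[OF R, folded A_def]
  have Lp: "0 < L * real p" using L p by simp
  have A: "0 < A" using Lp lo by (simp add: A_def)
  have s: "0 < s" "s\<^sup>2 = A" using A by (simp_all add: s_def A0_def A_def)
  have km: "(\<lambda>z. k (fst z) (snd z)) \<in> borel_measurable (R \<Otimes>\<^sub>M S)"
    using kernel_measurable
    by (subst measurable_cong_sets[OF sets_pair_measure_cong[OF sets] refl])
  have kd: "k (fst z) (snd z) = g (d z)" if "z \<in> space (R \<Otimes>\<^sub>M S)" for z
    using that by (auto simp: d_def space_pair_measure sp intro!: radial)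
  have d0: "0 \<le> d z" for z by (simp add: d_def vdist_nonneg)
  have dev: "(g (d z) - g s)\<^sup>2 \<le> \<Lambda>\<^sup>2 / A * ((d z)\<^sup>2 - A)\<^sup>2" for z
  proof -
    have "(g (d z) - g s)\<^sup>2 \<le> (\<Lambda> * \<bar>d z - s\<bar>)\<^sup>2"
      using lipschitz[OF d0, of s z] s by (subst power2_abs[symmetric]) (intro power_mono, auto)
    also have "\<dots> = \<Lambda>\<^sup>2 / A * ((d z - s)\<^sup>2 * A)" using A by (simp add: power_mult_distrib)
    also have "\<dots> \<le> \<Lambda>\<^sup>2 / A * ((d z - s)\<^sup>2 * (d z + s)\<^sup>2)"
      unfolding s(2)[symmetric] using s d0 by (intro mult_left_mono power_mono) auto
    also have "(d z - s)\<^sup>2 * (d z + s)\<^sup>2 = ((d z)\<^sup>2 - A)\<^sup>2"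
      unfolding s(2)[symmetric] by (simp add: power_mult_distrib[symmetric] square_diff_square_factored power2_eq_square ac_simps)
    finally show ?thesis .
  qed
  have devi: "integrable (R \<Otimes>\<^sub>M S) (\<lambda>z. \<Lambda>\<^sup>2 / A * ((d z)\<^sup>2 - A)\<^sup>2)"
    using conc(2) by (simp add: d_def)
  have i2: "integrable (R \<Otimes>\<^sub>M S) (\<lambda>z. (k (fst z) (snd z) - g s)\<^sup>2)"
    by (rule Bochner_Integration.integrable_bound[OF devi])
       (use km dev kd in \<open>auto intro!: AE_I2 simp: abs_of_nonneg A less_imp_le\<close>)
  have "(LINT z|(R \<Otimes>\<^sub>M S). (k (fst z) (snd z) - g s)\<^sup>2) \<le> (LINT z|(R \<Otimes>\<^sub>M S). \<Lambda>\<^sup>2 / A * ((d z)\<^sup>2 - A)\<^sup>2)"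
    using i2 devi by (rule integral_mono) (use dev kd in auto)
  also have "\<dots> = \<Lambda>\<^sup>2 / A * (LINT z|(R \<Otimes>\<^sub>M S). ((d z)\<^sup>2 - A)\<^sup>2)" by simp
  also have "\<dots> \<le> \<Lambda>\<^sup>2 / A * (16 * U * (real p * (2 * real a + 1)))"
    using conc(3) A by (intro mult_left_mono) (auto simp: d_def)
  also have "\<dots> \<le> \<Lambda>\<^sup>2 / (L * real p) * (16 * U * (real p * (2 * real a + 1)))"
  proof (intro mult_right_mono divide_left_mono)
    have "0 \<le> (LINT z|(R \<Otimes>\<^sub>M S). ((d z)\<^sup>2 - A)\<^sup>2)" by simp
    also have "\<dots> \<le> 16 * U * (real p * (2 * real a + 1))" using conc(3) by (simp only: d_def)
    finally show "0 \<le> 16 * U * (real p * (2 * real a + 1))" .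
  qed (use lo A Lp in \<open>auto simp: A_def\<close>)
  also have "\<dots> = \<Lambda>\<^sup>2 * (16 * U * (2 * real a + 1) / L)" using p by simp
  finally have e2: "(LINT z|(R \<Otimes>\<^sub>M S). (k (fst z) (snd z) - g s)\<^sup>2) \<le> \<Lambda>\<^sup>2 * (16 * U * (2 * real a + 1) / L)" .
  have "(\<lambda>z. k (fst z) (snd z) - g s) \<in> borel_measurable (R \<Otimes>\<^sub>M S)" using km by measurable
  from RS.expectation_abs_le_sqrt[OF this i2 e2]
  show dev1: "(LINT z|(R \<Otimes>\<^sub>M S). \<bar>k (fst z) (snd z) - g (A0 p R S)\<bar>) \<le> \<eta>"
    unfolding \<eta>_def s_def by (simp only: real_sqrt_mult real_sqrt_abs abs_of_nonneg[OF \<Lambda>_nonneg])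
  have sqb: "(k (fst z) (snd z))\<^sup>2 \<le> 2 * (g 0)\<^sup>2 + 2 * \<Lambda>\<^sup>2 * (d z)\<^sup>2" if "z \<in> space (R \<Otimes>\<^sub>M S)" for z
  proof -
    have "\<bar>g (d z)\<bar> \<le> \<bar>g 0\<bar> + \<Lambda> * d z" using lipschitz[OF d0, of 0 z] d0[of z] by auto
    then have "(g (d z))\<^sup>2 \<le> (\<bar>g 0\<bar> + \<Lambda> * d z)\<^sup>2" by (subst power2_abs[symmetric]) (intro power_mono, auto)
    also have "\<dots> \<le> 2 * (g 0)\<^sup>2 + 2 * \<Lambda>\<^sup>2 * (d z)\<^sup>2"
      using sum_squares_bound[of "\<bar>g 0\<bar>" "\<Lambda> * d z"] by (simp add: power2_sum power_mult_distrib)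
    finally show ?thesis using kd[OF that] by simp
  qed
  have sqi: "integrable (R \<Otimes>\<^sub>M S) (\<lambda>z. 2 * (g 0)\<^sup>2 + 2 * \<Lambda>\<^sup>2 * (d z)\<^sup>2)" using conc(1) by (simp add: d_def)
  show ksq: "integrable (R \<Otimes>\<^sub>M S) (\<lambda>z. (k (fst z) (snd z))\<^sup>2)"
    by (rule Bochner_Integration.integrable_bound[OF sqi])
       (use km sqb in \<open>auto intro!: AE_I2 simp: abs_of_nonneg\<close>)
  have "(LINT z|(R \<Otimes>\<^sub>M S). (k (fst z) (snd z))\<^sup>2) \<le> (LINT z|(R \<Otimes>\<^sub>M S). 2 * (g 0)\<^sup>2 + 2 * \<Lambda>\<^sup>2 * (d z)\<^sup>2)"
    using ksq sqi sqb by (rule integral_mono)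
  also have "\<dots> = 2 * (g 0)\<^sup>2 + 2 * \<Lambda>\<^sup>2 * A"
    using conc(1) RS.prob_space by (simp add: d_def A_def mean_sq_dist_def)
  also have "\<dots> \<le> \<kappa>" using up unfolding \<kappa>_def A_def by (intro add_left_mono mult_left_mono) auto
  finally show "(LINT z|(R \<Otimes>\<^sub>M S). (k (fst z) (snd z))\<^sup>2) \<le> \<kappa>" .
  show k1: "integrable (R \<Otimes>\<^sub>M S) (\<lambda>z. k (fst z) (snd z))"
    by (rule RS.square_integrable_imp_integrable[OF km ksq])
  have "kint k R S - g (A0 p R S) = (LINT z|(R \<Otimes>\<^sub>M S). k (fst z) (snd z) - g (A0 p R S))"
    using k1 RS.prob_space by (simp add: kint_def)
  then show "\<bar>kint k R S - g (A0 p R S)\<bar> \<le> \<eta>"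
    using dev1 integral_abs_bound[of "R \<Otimes>\<^sub>M S" "\<lambda>z. k (fst z) (snd z) - g (A0 p R S)"] by linarith
qed

lemma prob_space_\<Omega>: "prob_space \<Omega>"
  using samples by (simp add: two_samples_def)

sublocale prob_space \<Omega> by (rule prob_space_\<Omega>)

lemma indep: "indep_vars (\<lambda>_. Rp p) Z I"
  using samples by (simp add: two_samples_def Z_def I_def)

lemma Z_measurable: "u \<in> I \<Longrightarrow> Z u \<in> measurable \<Omega> (Rp p)"
  using indep by (auto simp: indep_vars_def)

lemma Z_space: "\<lbrakk>u \<in> I; \<omega> \<in> space \<Omega>\<rbrakk> \<Longrightarrow> Z u \<omega> \<in> space (Rp p)"
  using Z_measurable by (rule measurable_space)

lemma distr_Z: "u \<in> I \<Longrightarrow> distr \<Omega> (Rp p) (Z u) = law u"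
  using samples by (auto simp: two_samples_def Z_def I_def law_def)

lemma distr_pair:
  assumes u: "u \<in> I" and v: "v \<in> I" and uv: "u \<noteq> v"
  shows "distr \<Omega> (Rp p \<Otimes>\<^sub>M Rp p) (\<lambda>\<omega>. (Z u \<omega>, Z v \<omega>)) = law u \<Otimes>\<^sub>M law v"
proof -
  have "indep_var (PiM {u} (\<lambda>_. Rp p)) (\<lambda>\<omega>. restrict (\<lambda>i. Z i \<omega>) {u})
      (PiM {v} (\<lambda>_. Rp p)) (\<lambda>\<omega>. restrict (\<lambda>i. Z i \<omega>) {v})"
    using u v uv by (intro indep_var_restrict[OF indep]) auto
  from indep_var_compose[OF this measurable_component_singleton measurable_component_singleton, of u v]
  have "indep_var (Rp p) (Z u) (Rp p) (Z v)" by (simp add: comp_def)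
  then show ?thesis unfolding indep_var_distribution_eq using distr_Z[OF u] distr_Z[OF v] by simp
qed

lemma pair_measurable:
  assumes "u \<in> I" "v \<in> I"
  shows "(\<lambda>\<omega>. (Z u \<omega>, Z v \<omega>)) \<in> measurable \<Omega> (Rp p \<Otimes>\<^sub>M Rp p)"
  using Z_measurable assms by (intro measurable_Pair)

lemma kernel_Z_measurable:
  assumes "u \<in> I" "v \<in> I"
  shows "(\<lambda>\<omega>. k (Z u \<omega>) (Z v \<omega>)) \<in> borel_measurable \<Omega>"
  using measurable_compose[OF pair_measurable[OF assms] kernel_measurable] by simp

lemma transfer_pair:
  fixes \<phi> :: "real \<Rightarrow> real"
  assumes uv: "u \<in> I" "v \<in> I" "u \<noteq> v" and [measurable]: "\<phi> \<in> borel_measurable borel"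
  shows "integrable \<Omega> (\<lambda>\<omega>. \<phi> (k (Z u \<omega>) (Z v \<omega>))) \<longleftrightarrow>
           integrable (law u \<Otimes>\<^sub>M law v) (\<lambda>z. \<phi> (k (fst z) (snd z)))"
    and "expectation (\<lambda>\<omega>. \<phi> (k (Z u \<omega>) (Z v \<omega>))) = (LINT z|(law u \<Otimes>\<^sub>M law v). \<phi> (k (fst z) (snd z)))"
proof -
  note [measurable] = pair_measurable[OF uv(1,2)] kernel_measurable
  show "integrable \<Omega> (\<lambda>\<omega>. \<phi> (k (Z u \<omega>) (Z v \<omega>))) \<longleftrightarrow>
           integrable (law u \<Otimes>\<^sub>M law v) (\<lambda>z. \<phi> (k (fst z) (snd z)))"
    unfolding distr_pair[OF uv, symmetric] by (subst integrable_distr_eq) auto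
  show "expectation (\<lambda>\<omega>. \<phi> (k (Z u \<omega>) (Z v \<omega>))) = (LINT z|(law u \<Otimes>\<^sub>M law v). \<phi> (k (fst z) (snd z)))"
    unfolding distr_pair[OF uv, symmetric] by (subst integral_distr) auto
qed

lemma kernel_Z_diagonal: "\<lbrakk>u \<in> I; \<omega> \<in> space \<Omega>\<rbrakk> \<Longrightarrow> k (Z u \<omega>) (Z u \<omega>) = g 0"
  using radial[OF Z_space Z_space, of u \<omega> u \<omega>] by (simp add: vdist_def L2_set_def)

lemma kernel_Z_symmetric:
  "\<lbrakk>u \<in> I; v \<in> I; \<omega> \<in> space \<Omega>\<rbrakk> \<Longrightarrow> k (Z u \<omega>) (Z v \<omega>) = k (Z v \<omega>) (Z u \<omega>)"
  by (intro kernel_symmetric Z_space)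

lemma kernel_Z_square_off_diagonal:
  assumes "u \<in> I" "v \<in> I" "u \<noteq> v"
  shows "integrable \<Omega> (\<lambda>\<omega>. (k (Z u \<omega>) (Z v \<omega>))\<^sup>2)"
    and "expectation (\<lambda>\<omega>. (k (Z u \<omega>) (Z v \<omega>))\<^sup>2) \<le> \<kappa>"
proof -
  have *: "integrable \<Omega> (\<lambda>\<omega>. (k (Z u \<omega>) (Z v \<omega>))\<^sup>2) \<and> expectation (\<lambda>\<omega>. (k (Z u \<omega>) (Z v \<omega>))\<^sup>2) \<le> \<kappa>"
    if uv: "u \<in> I" "v \<in> I" "u \<noteq> v" and le: "isl v \<longrightarrow> isl u" for u v
  proof -
    note t = transfer_pair[OF uv, of "\<lambda>r. r\<^sup>2"]
    have "integrable (law u \<Otimes>\<^sub>M law v) (\<lambda>z. (k (fst z) (snd z))\<^sup>2) \<and>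
        (LINT z|(law u \<Otimes>\<^sub>M law v). (k (fst z) (snd z))\<^sup>2) \<le> \<kappa>"
      using le kernel_moments(1,2)[OF lawP lawP lower(1) upper(1)]
        kernel_moments(1,2)[OF lawP lawQ lower(2) upper(2)] kernel_moments(1,2)[OF lawQ lawQ lower(3) upper(3)]
      by (cases u; cases v) (auto simp: law_def)
    with t show ?thesis by simp
  qed
  have swap: "integrable \<Omega> (\<lambda>\<omega>. (k (Z u \<omega>) (Z v \<omega>))\<^sup>2) = integrable \<Omega> (\<lambda>\<omega>. (k (Z v \<omega>) (Z u \<omega>))\<^sup>2)"
    "expectation (\<lambda>\<omega>. (k (Z u \<omega>) (Z v \<omega>))\<^sup>2) = expectation (\<lambda>\<omega>. (k (Z v \<omega>) (Z u \<omega>))\<^sup>2)"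
    using assms kernel_Z_symmetric
    by (auto intro!: Bochner_Integration.integrable_cong Bochner_Integration.integral_cong)
  show "integrable \<Omega> (\<lambda>\<omega>. (k (Z u \<omega>) (Z v \<omega>))\<^sup>2)" "expectation (\<lambda>\<omega>. (k (Z u \<omega>) (Z v \<omega>))\<^sup>2) \<le> \<kappa>"
    using *[of u v] *[of v u] swap assms by auto
qed

lemma \<kappa>_ge: "(g 0)\<^sup>2 \<le> \<kappa>"
proof -
  have "0 \<le> U' * real p" using lower(1) upper(1) L by (meson mult_nonneg_nonneg of_nat_0_le_iff less_imp_le order.trans)
  then show ?thesis unfolding \<kappa>_def by (simp add: add_increasing2)
qed

lemma kernel_Z_square:
  assumes "u \<in> I" "v \<in> I"
  shows "integrable \<Omega> (\<lambda>\<omega>. (k (Z u \<omega>) (Z v \<omega>))\<^sup>2)"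
    and "expectation (\<lambda>\<omega>. (k (Z u \<omega>) (Z v \<omega>))\<^sup>2) \<le> \<kappa>"
proof -
  have "integrable \<Omega> (\<lambda>\<omega>. (k (Z u \<omega>) (Z v \<omega>))\<^sup>2) \<and> expectation (\<lambda>\<omega>. (k (Z u \<omega>) (Z v \<omega>))\<^sup>2) \<le> \<kappa>"
  proof (cases "u = v")
    case True
    have "integrable \<Omega> (\<lambda>\<omega>. (k (Z u \<omega>) (Z u \<omega>))\<^sup>2) = integrable \<Omega> (\<lambda>\<omega>. (g 0)\<^sup>2)"
      "expectation (\<lambda>\<omega>. (k (Z u \<omega>) (Z u \<omega>))\<^sup>2) = expectation (\<lambda>\<omega>. (g 0)\<^sup>2)"
      using kernel_Z_diagonal[OF assms(1)]
      by (intro Bochner_Integration.integrable_cong Bochner_Integration.integral_cong refl; simp)+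
    then show ?thesis using \<kappa>_ge True by (simp add: prob_space)
  qed (use kernel_Z_square_off_diagonal assms in auto)
  then show "integrable \<Omega> (\<lambda>\<omega>. (k (Z u \<omega>) (Z v \<omega>))\<^sup>2)"
    "expectation (\<lambda>\<omega>. (k (Z u \<omega>) (Z v \<omega>))\<^sup>2) \<le> \<kappa>" by auto
qed

lemma kernel_Z_integrable: "\<lbrakk>u \<in> I; v \<in> I\<rbrakk> \<Longrightarrow> integrable \<Omega> (\<lambda>\<omega>. k (Z u \<omega>) (Z v \<omega>))"
  using square_integrable_imp_integrable[OF kernel_Z_measurable kernel_Z_square(1)] by blast

lemma kernel_Z_expectation:
  "\<lbrakk>u \<in> I; v \<in> I; u \<noteq> v\<rbrakk> \<Longrightarrow> expectation (\<lambda>\<omega>. k (Z u \<omega>) (Z v \<omega>)) = kint k (law u) (law v)"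
  using transfer_pair(2)[of u v "\<lambda>r. r"] by (simp add: kint_def)

section \<open>Sign of the population energy distance\<close>

lemma kint_commute: "kint k Q P = kint k P Q"
proof -
  have I1: "Inl 1 \<in> I" "Inr 1 \<in> I" by (auto simp: I_def)
  have "expectation (\<lambda>\<omega>. k (Z (Inr 1) \<omega>) (Z (Inl 1) \<omega>)) = expectation (\<lambda>\<omega>. k (Z (Inl 1) \<omega>) (Z (Inr 1) \<omega>))"
    using kernel_Z_symmetric[OF I1] by (intro Bochner_Integration.integral_cong) auto
  then show ?thesis using kernel_Z_expectation[OF I1] kernel_Z_expectation[OF I1(2,1)] by (simp add: law_def)
qed

text \<open>The quadratic form of \<open>k\<close> at \<open>n\<close> points of each sample, with weights 1 and -1, is at most 0 since \<open>- k\<close>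
is positive semidefinite. Put \<open>\<theta> = kint k P P + kint k Q Q - 2 * kint k P Q\<close>. In expectation the form is
\<open>n\<^sup>2 \<theta>\<close> plus a correction for the diagonal, which is a fixed multiple of \<open>n\<close>; letting \<open>n\<close> grow gives
\<open>\<theta> \<le> 0\<close>.\<close>

lemma energy_distance_nonneg_reproducing:
  assumes ch: "characteristic_reproducing_kernel p (\<lambda>x y. - k x y)"
  shows "kint k P P + kint k Q Q \<le> 2 * kint k P Q"
proof -
  obtain H ip where rk: "rkhs (space (Rp p)) H ip (\<lambda>x y. - k x y)"
    using ch by (auto simp: characteristic_reproducing_kernel_def)
  define \<theta> where "\<theta> = kint k P P + kint k Q Q - 2 * kint k P Q"
  define r where "r = kint k P P + kint k Q Q - 2 * g 0"
  have le: "real n * \<theta> \<le> r" if n: "1 \<le> n" for n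
  proof -
    define J where "J = ({1..n} <+> {1..n} :: (nat + nat) set)"
    define c where "c = (case_sum (\<lambda>_. 1) (\<lambda>_. -1) :: nat + nat \<Rightarrow> real)"
    have J: "finite J" "J \<subseteq> I" by (auto simp: J_def I_def)
    have pos: "0 \<le> - (\<Sum>u\<in>J. \<Sum>v\<in>J. c u * c v * k (Z u \<omega>) (Z v \<omega>))" if w: "\<omega> \<in> space \<Omega>" for \<omega>
      using rkhs_positive_semidefinite[OF rk J(1), of "\<lambda>u. Z u \<omega>" c] Z_space w J(2)
      by (auto simp: sum_negf)
    define q where "q = (\<lambda>u v. expectation (\<lambda>\<omega>. k (Z u \<omega>) (Z v \<omega>)))"
    have inner: "integrable \<Omega> (\<lambda>\<omega>. \<Sum>v\<in>J. c u * c v * k (Z u \<omega>) (Z v \<omega>))" if "u \<in> J" for u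
      using that J kernel_Z_integrable by (intro Bochner_Integration.integrable_sum integrable_mult_right) auto
    have "expectation (\<lambda>\<omega>. \<Sum>u\<in>J. \<Sum>v\<in>J. c u * c v * k (Z u \<omega>) (Z v \<omega>))
        = (\<Sum>u\<in>J. expectation (\<lambda>\<omega>. \<Sum>v\<in>J. c u * c v * k (Z u \<omega>) (Z v \<omega>)))"
      using inner by (rule Bochner_Integration.integral_sum)
    also have "\<dots> = (\<Sum>u\<in>J. \<Sum>v\<in>J. expectation (\<lambda>\<omega>. c u * c v * k (Z u \<omega>) (Z v \<omega>)))"
      using J kernel_Z_integrable
      by (intro sum.cong refl Bochner_Integration.integral_sum integrable_mult_right) auto
    also have "\<dots> = (\<Sum>u\<in>J. \<Sum>v\<in>J. c u * c v * q u v)" by (simp add: q_def)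
    finally have E: "expectation (\<lambda>\<omega>. \<Sum>u\<in>J. \<Sum>v\<in>J. c u * c v * k (Z u \<omega>) (Z v \<omega>)) = \<dots>" .
    have "0 \<le> expectation (\<lambda>\<omega>. - (\<Sum>u\<in>J. \<Sum>v\<in>J. c u * c v * k (Z u \<omega>) (Z v \<omega>)))"
      using pos by (rule Bochner_Integration.integral_nonneg)
    then have le0: "(\<Sum>u\<in>J. \<Sum>v\<in>J. c u * c v * q u v) \<le> 0" using E by simp
    have qn: "q u v = kint k (law u) (law v)" if "u \<in> J" "v \<in> J" "u \<noteq> v" for u v
      using kernel_Z_expectation[of u v] that J by (auto simp: q_def)
    have qd: "q u u = g 0" if "u \<in> J" for u
    proof -
      have "q u u = expectation (\<lambda>\<omega>. g 0)" unfolding q_def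
        using kernel_Z_diagonal[of u] that J by (intro Bochner_Integration.integral_cong) auto
      then show ?thesis by (simp add: prob_space)
    qed
    have q: "q u v = kint k (law u) (law v) + (if u = v then g 0 - kint k (law u) (law u) else 0)"
      if "u \<in> J" "v \<in> J" for u v using qn[OF that] qd that by auto
    have "(\<Sum>u\<in>J. \<Sum>v\<in>J. c u * c v * q u v) = (\<Sum>u\<in>J. \<Sum>v\<in>J. c u * c v * kint k (law u) (law v)
        + (if u = v then c u * c u * (g 0 - kint k (law u) (law u)) else 0))"
      using q by (intro sum.cong refl) (simp add: algebra_simps)
    also have "\<dots> = (\<Sum>u\<in>J. \<Sum>v\<in>J. c u * c v * kint k (law u) (law v))
        + (\<Sum>u\<in>J. c u * c u * (g 0 - kint k (law u) (law u)))"
      using J(1) by (simp add: sum.distrib)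
    also have "\<dots> = real n * (real n * \<theta>) - real n * r"
      by (simp add: J_def sum.Plus c_def law_def comp_def \<theta>_def r_def kint_commute algebra_simps)
    also have "\<dots> = real n * (real n * \<theta> - r)" by (simp add: algebra_simps)
    finally show ?thesis using le0 n by (simp add: mult_le_0_iff)
  qed
  have "\<theta> \<le> 0"
  proof (rule ccontr)
    assume "\<not> \<theta> \<le> 0"
    then obtain n where n: "max r 0 < real n * \<theta>"
      using reals_Archimedean3[of \<theta>] not_le by blast
    then have "1 \<le> n" by (cases n) auto
    with le[of n] n show False by simp
  qed
  then show ?thesis by (simp add: \<theta>_def)
qed

lemma energy_distance_pos_strong_negative_type:
  assumes neg: "strong_negative_type p k" and PQ: "P \<noteq> Q"
  shows "kint k P P + kint k Q Q < 2 * kint k P Q"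
proof -
  interpret P: prob_space P by (rule prob_spaces)
  interpret Q: prob_space Q by (rule prob_spaces)
  interpret PP: pair_sigma_finite P P ..
  interpret QP: pair_sigma_finite Q P ..
  interpret PQ: pair_sigma_finite P Q ..
  \<comment> \<open>By Fubini, almost every point of the first law can serve as base point for both laws.\<close>
  have "AE z\<^sub>0 in P. integrable P (\<lambda>z. k z\<^sub>0 z)" "AE z\<^sub>0 in P. integrable Q (\<lambda>z. k z\<^sub>0 z)"
    using PP.AE_integrable_fst'[OF kernel_moments(3)[OF lawP lawP lower(1) upper(1)]]
      PQ.AE_integrable_fst'[OF kernel_moments(3)[OF lawP lawQ lower(2) upper(2)]] by simp_all
  then have ae: "AE z\<^sub>0 in P. z\<^sub>0 \<in> space P \<and> integrable P (\<lambda>z. k z\<^sub>0 z) \<and> integrable Q (\<lambda>z. k z\<^sub>0 z)"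
    using AE_space by eventually_elim auto
  obtain z\<^sub>0 where z: "z\<^sub>0 \<in> space (Rp p)" "integrable P (\<lambda>z. k z\<^sub>0 z)" "integrable Q (\<lambda>z. k z\<^sub>0 z)"
    using eventually_happens'[OF P.ae_filter_bot ae] space_eq by auto
  have "integrable P (\<lambda>z. k z z\<^sub>0)" "integrable Q (\<lambda>z. k z z\<^sub>0)"
    using z(2,3) kernel_symmetric[OF z(1)] space_eq
      Bochner_Integration.integrable_cong[of P P "\<lambda>z. k z z\<^sub>0" "\<lambda>z. k z\<^sub>0 z"]
      Bochner_Integration.integrable_cong[of Q Q "\<lambda>z. k z z\<^sub>0" "\<lambda>z. k z\<^sub>0 z"]
    by simp_all
  then have "kint k P P - kint k P Q - kint k Q P + kint k Q Q < 0"
    using neg borel_probs PQ z(1) unfolding strong_negative_type_def by blast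
  then show ?thesis by (simp add: kint_commute)
qed

lemma energy_distance_nonneg: "kint k P P + kint k Q Q \<le> 2 * kint k P Q"
proof (cases "P = Q")
  case False
  then show ?thesis
    using kernel energy_distance_nonneg_reproducing energy_distance_pos_strong_negative_type
    by (auto simp: kernel_on_def)
qed simp

text \<open>The limiting value of the numerator cannot be substantially negative: up to the concentration error it
is the population energy distance, which is nonnegative for both types of kernel.\<close>

lemma gap_lower: "- 4 * \<eta> \<le> 2 * g (A0 p P Q) - g (A0 p P P) - g (A0 p Q Q)"
  using energy_distance_nonneg kernel_moments(5)[OF lawP lawP lower(1) upper(1)]
    kernel_moments(5)[OF lawP lawQ lower(2) upper(2)] kernel_moments(5)[OF lawQ lawQ lower(3) upper(3)]
  by linarith

text \<open>A kernel that vanishes identically cannot separate \<open>P\<close> from \<open>Q\<close> in either of the two senses allowed.\<close>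

lemma profile_nonzero:
  assumes PQ: "P \<noteq> Q"
  shows "\<exists>u\<ge>0. g u \<noteq> 0"
proof (rule ccontr)
  assume "\<not> ?thesis"
  then have k0: "k x y = 0" if "x \<in> space (Rp p)" "y \<in> space (Rp p)" for x y
    using radial[OF that] vdist_nonneg by auto
  have "kint k R S = 0" if "space R = space (Rp p)" "space S = space (Rp p)" for R S
    unfolding kint_def using k0 that by (intro integral_eq_zero_AE AE_I2) (auto simp: space_pair_measure)
  then have "kint k P P + kint k Q Q = 2 * kint k P Q" using space_eq by simp
  then have "\<not> strong_negative_type p k" using energy_distance_pos_strong_negative_type PQ by auto
  then have "characteristic_reproducing_kernel p (\<lambda>x y. - k x y)" using kernel by (simp add: kernel_on_def)
  from rkhs_zero_not_characteristic[OF this _ borel_probs] k0 PQ show False by simp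
qed

lemma T_stat_prob:
  assumes n: "2 \<le> n" "2 \<le> m"
    and gap: "G \<le> 2 * g (A0 p P Q) - g (A0 p P P) - g (A0 p Q Q)" and pos: "0 < G" "0 < C"
  shows "1 - 16 * \<eta> / G - 1600 * \<kappa> * C\<^sup>2 * c_nm n m / G\<^sup>2
     \<le> prob {\<omega> \<in> space \<Omega>. C < T_stat k (g 0) n m (\<lambda>i. X i \<omega>) (\<lambda>j. Y j \<omega>)}"
proof (rule T_stat_exceeds_prob[OF n _ _ _ _ _ _ _ _ gap pos], unfold Z_def[symmetric] I_def[symmetric])
  fix i j :: nat
  show "expectation (\<lambda>\<omega>. \<bar>k (X i \<omega>) (Y j \<omega>) - g (A0 p P Q)\<bar>) \<le> \<eta>" if "1 \<le> i" "1 \<le> j"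
    using transfer_pair(2)[of "Inl i" "Inr j" "\<lambda>r. \<bar>r - g (A0 p P Q)\<bar>"] that
      kernel_moments(4)[OF lawP lawQ lower(2) upper(2)]
    by (simp add: I_def InlI InrI law_def) (simp add: Z_def)
  show "expectation (\<lambda>\<omega>. \<bar>k (X i \<omega>) (X j \<omega>) - g (A0 p P P)\<bar>) \<le> \<eta>" if "1 \<le> i" "i < j"
    using transfer_pair(2)[of "Inl i" "Inl j" "\<lambda>r. \<bar>r - g (A0 p P P)\<bar>"] that
      kernel_moments(4)[OF lawP lawP lower(1) upper(1)]
    by (simp add: I_def InlI InrI law_def) (simp add: Z_def)
  show "expectation (\<lambda>\<omega>. \<bar>k (Y i \<omega>) (Y j \<omega>) - g (A0 p Q Q)\<bar>) \<le> \<eta>" if "1 \<le> i" "i < j"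
    using transfer_pair(2)[of "Inr i" "Inr j" "\<lambda>r. \<bar>r - g (A0 p Q Q)\<bar>"] that
      kernel_moments(4)[OF lawQ lawQ lower(3) upper(3)]
    by (simp add: I_def InlI InrI law_def) (simp add: Z_def)
qed (use kernel_Z_measurable kernel_Z_diagonal kernel_Z_symmetric kernel_Z_square in auto)

end

section \<open>Consistency\<close>

lemma lipschitz_of_derivative_family:
  assumes der: "derivative_family fd D" and D: "{0..} \<subseteq> D"
    and bound: "\<And>s. s \<in> D \<Longrightarrow> \<bar>fd 1 s\<bar> \<le> \<Lambda>"
    and uv: "0 \<le> u" "0 \<le> (v::real)"
  shows "\<bar>fd 0 u - fd 0 v\<bar> \<le> \<Lambda> * \<bar>u - v\<bar>"
proof -
  have "(fd 0 has_field_derivative fd 1 s) (at s within {0..})" if "s \<in> {0..}" for s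
  proof -
    have "s \<in> D" using D that by auto
    then have "(fd 0 has_real_derivative fd (Suc 0) s) (at s within D)"
      using der[unfolded derivative_family_def, rule_format, of 0 s] by simp
    then show ?thesis using D by (simp add: DERIV_subset)
  qed
  from field_differentiable_bound[OF _ this, of \<Lambda> u v]
  have "norm (fd 0 u - fd 0 v) \<le> \<Lambda> * norm (u - v)"
    using D bound uv by auto
  then show ?thesis by simp
qed

lemma tendsto_c_nm:
  assumes n: "filterlim n at_top sequentially" and m: "filterlim m at_top sequentially"
  shows "(\<lambda>l. c_nm (n l) (m l)) \<longlonglongrightarrow> 0"
proof -
  have N: "filterlim (\<lambda>l. real (n l)) at_top sequentially"
    by (rule filterlim_compose[OF filterlim_real_sequentially n])
  have M: "filterlim (\<lambda>l. real (m l)) at_top sequentially"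
    by (rule filterlim_compose[OF filterlim_real_sequentially m])
  have N1: "filterlim (\<lambda>l. real (n l) - 1) at_top sequentially"
    using filterlim_tendsto_add_at_top[OF tendsto_const[of "-1"] N] by simp
  have M1: "filterlim (\<lambda>l. real (m l) - 1) at_top sequentially"
    using filterlim_tendsto_add_at_top[OF tendsto_const[of "-1"] M] by simp
  have z: "(\<lambda>l. c / g l) \<longlonglongrightarrow> 0" if "filterlim g at_top sequentially" for c :: real and g
    by (rule tendsto_divide_0[OF tendsto_const filterlim_at_top_imp_at_infinity[OF that]])
  show ?thesis
    unfolding c_nm_def
    using tendsto_add_zero[OF tendsto_add_zero[OF z[OF filterlim_at_top_mult_at_top[OF N N1]]
        z[OF filterlim_at_top_mult_at_top[OF N M]]] z[OF filterlim_at_top_mult_at_top[OF M M1]]] .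
qed

text \<open>Here everything is measured in units of \<open>F = \<bar>f (A0 p P Q)\<bar>\<close>, \<open>f = fd 0\<close>, which then cancels from the bound. With
\<open>s = A0 p P Q\<close> the derivative condition makes \<open>f\<close> Lipschitz with constant \<open>B F / s\<close>. Since \<open>s\<close> is at least of
order \<open>\<surd>p\<close>, the concentration error is \<open>F \<epsilon>\<close> with \<open>\<epsilon>\<close> of order \<open>1 / \<surd>p\<close>, and the second moment of the kernel
is at most \<open>F\<^sup>2 \<gamma>\<close>. Moreover \<open>F\<close> is positive, because \<open>F = 0\<close> would make the Lipschitz constant zero and
the kernel identically zero. Once \<open>4 \<epsilon> < L_star\<close> the gap condition without its absolute value holds, as
the negative alternative would contradict the sign of the population energy distance.\<close>

lemma T_stat_prob_lower_bound:
  fixes fd :: "nat \<Rightarrow> real \<Rightarrow> real" and p a :: nat and U L U' B L_star C :: real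
  defines "\<epsilon> \<equiv> B * sqrt (16 * U * (2 * real a + 1) / L) / sqrt (L * real p)"
    and "\<gamma> \<equiv> 2 * (1 + B)\<^sup>2 + 2 * B\<^sup>2 * U' / L"
  assumes p: "1 \<le> p" and law: "short_range_law p a U P" "short_range_law p a U Q"
    and samples: "two_samples p \<Omega> P Q X Y" and kernel: "kernel_on p k"
    and radial: "\<And>x y. \<lbrakk>x \<in> space (Rp p); y \<in> space (Rp p)\<rbrakk> \<Longrightarrow> k x y = fd 0 (vdist p x y)"
    and der: "derivative_family fd D" and D: "{0..} \<subseteq> D" and D0: "A0 p P Q \<in> D0"
    and K2: "cond_K2 fd D D0 B" and B: "0 \<le> B"
    and L: "0 < L"
    and lower: "L * real p \<le> mean_sq_dist p P P" "L * real p \<le> mean_sq_dist p P Q" "L * real p \<le> mean_sq_dist p Q Q"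
    and upper: "mean_sq_dist p P P \<le> U' * real p" "mean_sq_dist p P Q \<le> U' * real p" "mean_sq_dist p Q Q \<le> U' * real p"
    and PQ: "P \<noteq> Q"
    and gap: "0 < L_star" "L_star * \<bar>fd 0 (A0 p P Q)\<bar> \<le> \<bar>2 * fd 0 (A0 p P Q) - fd 0 (A0 p P P) - fd 0 (A0 p Q Q)\<bar>"
    and C: "0 < C" and n: "2 \<le> n" "2 \<le> m" and small: "4 * \<epsilon> < L_star"
  shows "1 - 16 * \<epsilon> / L_star - 1600 * \<gamma> * C\<^sup>2 * c_nm n m / L_star\<^sup>2
    \<le> measure \<Omega> {\<omega> \<in> space \<Omega>. C < T_stat k (fd 0 0) n m (\<lambda>i. X i \<omega>) (\<lambda>j. Y j \<omega>)}"
proof -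
  define s where "s = A0 p P Q"
  define F0 where "F0 = \<bar>fd 0 s\<bar>"
  define \<Lambda> where "\<Lambda> = B * F0 / s"
  have Lp: "0 < L * real p" using L p by simp
  have s2: "s\<^sup>2 = mean_sq_dist p P Q" using Lp lower(2) by (simp add: s_def A0_def)
  have s: "sqrt (L * real p) \<le> s" using lower(2) by (simp add: s_def A0_def)
  have s0: "0 < s" by (rule less_le_trans[OF _ s]) (use Lp in simp)
  have Lip: "\<bar>fd 0 u - fd 0 v\<bar> \<le> \<Lambda> * \<bar>u - v\<bar>" if "0 \<le> u" "0 \<le> v" for u v
  proof (rule lipschitz_of_derivative_family[OF der D _ that])
    fix t assume "t \<in> D"
    then have "\<bar>fd 1 t\<bar> * \<bar>s ^ 1\<bar> \<le> B * F0"
      using K2[unfolded cond_K2_def, rule_format, OF D0, of 1 t] by (simp add: s_def F0_def)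
    then show "\<bar>fd 1 t\<bar> \<le> \<Lambda>" using s0 by (simp add: \<Lambda>_def pos_le_divide_eq)
  qed
  interpret radial_two_samples p a U L U' \<Lambda> \<Omega> P Q X Y k "fd 0"
    by unfold_locales (fact p law samples kernel radial Lip L lower upper)+
  have F0: "0 < F0"
  proof (rule ccontr)
    assume "\<not> 0 < F0"
    then have z: "fd 0 s = 0" "\<Lambda> = 0" by (simp_all add: F0_def \<Lambda>_def)
    obtain u where "0 \<le> u" "fd 0 u \<noteq> 0" using profile_nonzero[OF PQ] by auto
    with Lip[of u s] z s0 show False by simp
  qed
  have \<eta>: "\<eta> \<le> F0 * \<epsilon>"
  proof -
    have U0: "0 \<le> sqrt (16 * U * (2 * real a + 1) / L)"
    proof -
      have "0 \<le> U" by (rule short_range_law_bound_nonneg[OF law(1) p])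
      then show ?thesis using L by simp
    qed
    have "\<eta> = F0 * B * sqrt (16 * U * (2 * real a + 1) / L) / s" unfolding \<eta>_def by (simp add: \<Lambda>_def)
    also have "\<dots> \<le> F0 * B * sqrt (16 * U * (2 * real a + 1) / L) / sqrt (L * real p)"
      using F0 B U0 s Lp s0 by (intro divide_left_mono mult_nonneg_nonneg) auto
    also have "\<dots> = F0 * \<epsilon>" by (simp add: \<epsilon>_def)
    finally show ?thesis .
  qed
  have \<kappa>: "\<kappa> \<le> F0\<^sup>2 * \<gamma>"
  proof -
    have "\<bar>fd 0 0\<bar> \<le> F0 + \<Lambda> * s" using Lip[of 0 s] s0 by (auto simp: F0_def)
    also have "\<dots> = F0 * (1 + B)" using s0 by (simp add: \<Lambda>_def algebra_simps)
    finally have 1: "(fd 0 0)\<^sup>2 \<le> (F0 * (1 + B))\<^sup>2" by (subst power2_abs[symmetric]) (intro power_mono, auto)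
    have "0 < U' * real p" using Lp lower(1) upper(1) by linarith
    then have U': "0 \<le> U'" using p by (simp add: zero_less_mult_iff)
    have "\<Lambda>\<^sup>2 * (U' * real p) = F0\<^sup>2 * B\<^sup>2 * (U' * real p) / mean_sq_dist p P Q"
      by (simp add: \<Lambda>_def power_divide power_mult_distrib s2)
    also have "\<dots> \<le> F0\<^sup>2 * B\<^sup>2 * (U' * real p) / (L * real p)"
      using U' Lp lower(2) by (intro divide_left_mono) auto
    also have "\<dots> = F0\<^sup>2 * (B\<^sup>2 * U' / L)" using p by simp
    finally have 2: "\<Lambda>\<^sup>2 * (U' * real p) \<le> F0\<^sup>2 * (B\<^sup>2 * U' / L)" .
    have "\<kappa> = 2 * (fd 0 0)\<^sup>2 + 2 * (\<Lambda>\<^sup>2 * (U' * real p))" unfolding \<kappa>_def by simp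
    also have "\<dots> \<le> 2 * (F0 * (1 + B))\<^sup>2 + 2 * (F0\<^sup>2 * (B\<^sup>2 * U' / L))" using 1 2 by linarith
    also have "\<dots> = F0\<^sup>2 * \<gamma>" unfolding \<gamma>_def power_mult_distrib by (simp add: algebra_simps)
    finally show ?thesis .
  qed
  have "4 * \<eta> \<le> 4 * (F0 * \<epsilon>)" using \<eta> by (rule mult_left_mono) simp
  also have "\<dots> = 4 * \<epsilon> * F0" by (simp only: ac_simps)
  also have "\<dots> < L_star * F0" by (rule mult_strict_right_mono[OF small F0])
  finally have "4 * \<eta> < L_star * F0" .
  moreover have "L_star * F0 \<le> \<bar>2 * fd 0 (A0 p P Q) - fd 0 (A0 p P P) - fd 0 (A0 p Q Q)\<bar>"
    using gap(2) by (simp only: F0_def s_def)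
  ultimately have G: "L_star * F0 \<le> 2 * fd 0 (A0 p P Q) - fd 0 (A0 p P P) - fd 0 (A0 p Q Q)"
    using gap_lower by linarith
  have c: "0 \<le> c_nm n m" using c_nm_pos[OF n] by simp
  have "1 - 16 * \<eta> / (L_star * F0) - 1600 * \<kappa> * C\<^sup>2 * c_nm n m / (L_star * F0)\<^sup>2
     \<le> prob {\<omega> \<in> space \<Omega>. C < T_stat k (fd 0 0) n m (\<lambda>i. X i \<omega>) (\<lambda>j. Y j \<omega>)}"
    by (rule T_stat_prob[OF n G _ C]) (use gap(1) F0 in simp)
  moreover have "16 * \<eta> / (L_star * F0) \<le> 16 * (F0 * \<epsilon>) / (L_star * F0)"
    using \<eta> gap(1) F0 by (intro divide_right_mono) auto
  moreover have "1600 * \<kappa> * C\<^sup>2 * c_nm n m / (L_star * F0)\<^sup>2 \<le> 1600 * (F0\<^sup>2 * \<gamma>) * C\<^sup>2 * c_nm n m / (L_star * F0)\<^sup>2"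
    by (rule divide_right_mono[OF mult_right_mono[OF mult_right_mono[OF mult_left_mono[OF \<kappa>]] c]]) auto
  moreover have "16 * (F0 * \<epsilon>) / (L_star * F0) = 16 * \<epsilon> / L_star" using F0 by simp
  moreover have "1600 * (F0\<^sup>2 * \<gamma>) * C\<^sup>2 * c_nm n m / (L_star * F0)\<^sup>2 = 1600 * \<gamma> * C\<^sup>2 * c_nm n m / L_star\<^sup>2"
    using F0 by (simp add: power_mult_distrib)
  ultimately show ?thesis by linarith
qed

theorem proposition21:
  fixes \<rho> L\<^sub>1 U\<^sub>1 L_star C :: real
    and P Q :: "nat \<Rightarrow> vec measure"
    and \<Omega> :: "nat \<Rightarrow> 'a measure"
    and X Y :: "nat \<Rightarrow> nat \<Rightarrow> 'a \<Rightarrow> vec"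
    and \<C> :: "(nat \<Rightarrow> kern) set"
    and f :: "(nat \<Rightarrow> kern) \<Rightarrow> nat \<Rightarrow> nat \<Rightarrow> real \<Rightarrow> real"
    and D D0 :: "(nat \<Rightarrow> kern) \<Rightarrow> nat \<Rightarrow> real set"
    and \<alpha> n m d :: "nat \<Rightarrow> nat"
    and k :: "nat \<Rightarrow> kern"
  assumes rho: "0 < \<rho>" "\<rho> < 1"
    and laws: "\<And>p. 1 \<le> p \<Longrightarrow> borel_prob p (P p) \<and> borel_prob p (Q p)"
    and samples: "\<And>p. 1 \<le> p \<Longrightarrow> two_samples p (\<Omega> p) (P p) (Q p) (X p) (Y p)"
    and kernels: "\<And>\<kappa> p. \<lbrakk>\<kappa> \<in> \<C>; 1 \<le> p\<rbrakk> \<Longrightarrow> kernel_on p (\<kappa> p)"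
    and radial: "\<And>\<kappa> p x y. \<lbrakk>\<kappa> \<in> \<C>; 1 \<le> p; x \<in> space (Rp p); y \<in> space (Rp p)\<rbrakk>
                  \<Longrightarrow> \<kappa> p x y = f \<kappa> p 0 (vdist p x y)"
    and derivs: "\<And>\<kappa> p. \<lbrakk>\<kappa> \<in> \<C>; 1 \<le> p\<rbrakk> \<Longrightarrow> derivative_family (f \<kappa> p) (D \<kappa> p)"
    and domain: "\<And>\<kappa> p. \<lbrakk>\<kappa> \<in> \<C>; 1 \<le> p\<rbrakk> \<Longrightarrow> {0..} \<subseteq> D \<kappa> p \<and> D0 \<kappa> p \<subseteq> D \<kappa> p"
    and D0: "\<And>\<kappa> p. \<lbrakk>\<kappa> \<in> \<C>; 1 \<le> p\<rbrakk> \<Longrightarrow>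
               A0 p (mixture \<rho> (P p) (Q p)) (mixture \<rho> (P p) (Q p)) \<in> D0 \<kappa> p \<and>
               A0 p (P p) (Q p) \<in> D0 \<kappa> p"
    and K1: "\<And>\<kappa> p. \<lbrakk>\<kappa> \<in> \<C>; 1 \<le> p\<rbrakk> \<Longrightarrow> cond_K1 (f \<kappa> p) (D \<kappa> p) (D0 \<kappa> p)"
    and K2: "\<exists>B. \<forall>\<kappa>\<in>\<C>. \<forall>p\<ge>1. cond_K2 (f \<kappa> p) (D \<kappa> p) (D0 \<kappa> p) B"
    and D1: "cond_D1 P Q \<alpha>"
    and D2: "cond_D2 P Q"
    and D3: "cond_D3 P Q"
    and alpha_bounded: "(\<lambda>p. real (\<alpha> p)) \<in> O(\<lambda>_. 1)"
    and moment_gap: "0 < L\<^sub>1" "0 < U\<^sub>1"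
      "\<And>p. 1 \<le> p \<Longrightarrow>
         (let G = max ((mean_diff_norm p (P p) (Q p))\<^sup>2)
                      \<bar>centred_second_moment p (P p) - centred_second_moment p (Q p)\<bar>
          in L\<^sub>1 * real p \<le> G \<and> G \<le> U\<^sub>1 * real p)"
    and fourth_moment: "\<And>\<kappa> p. \<lbrakk>\<kappa> \<in> \<C>; 1 \<le> p\<rbrakk> \<Longrightarrow>
         integrable (mixture \<rho> (P p) (Q p) \<Otimes>\<^sub>M mixture \<rho> (P p) (Q p))
           (\<lambda>z. (\<kappa> p (fst z) (snd z)) ^ 4)"
    and to_infinity: "filterlim n at_top sequentially" "filterlim m at_top sequentially"
      "filterlim d at_top sequentially"
    and ratio: "(\<lambda>l. real (n l) / real (n l + m l) - \<rho>) \<in> O(\<lambda>l. 1 / real (n l + m l))"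
    and k: "k \<in> \<C>"
    and L_star: "0 < L_star"
      "\<And>p. 1 \<le> p \<Longrightarrow>
         L_star * \<bar>f k p 0 (A0 p (P p) (Q p))\<bar> \<le>
         \<bar>2 * f k p 0 (A0 p (P p) (Q p)) - f k p 0 (A0 p (P p) (P p)) - f k p 0 (A0 p (Q p) (Q p))\<bar>"
    and C: "0 < C"
  shows "(\<lambda>l. measure (\<Omega> (d l)) {\<omega> \<in> space (\<Omega> (d l)).
            C < T_stat (k (d l)) (f k (d l) 0 0) (n l) (m l)
                  (\<lambda>i. X (d l) i \<omega>) (\<lambda>j. Y (d l) j \<omega>)}) \<longlonglongrightarrow> 1"
proof -
  obtain B0 where B0: "\<And>p. 1 \<le> p \<Longrightarrow> cond_K2 (f k p) (D k p) (D0 k p) B0" using K2 k by blast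
  \<comment> \<open>The derivative condition does not say that its constant is nonnegative.\<close>
  define B where "B = \<bar>B0\<bar>"
  have B: "0 \<le> B" and K2': "cond_K2 (f k p) (D k p) (D0 k p) B" if "1 \<le> p" for p
  proof -
    show "0 \<le> B" by (simp add: B_def)
    have "B0 * \<bar>f k p 0 s\<^sub>0\<bar> \<le> B * \<bar>f k p 0 s\<^sub>0\<bar>" for s\<^sub>0 by (simp add: B_def mult_right_mono)
    then show "cond_K2 (f k p) (D k p) (D0 k p) B"
      unfolding cond_K2_def
      by (intro ballI order.trans[OF B0[OF that, unfolded cond_K2_def, rule_format]])
  qed
  obtain U where U: "\<And>p j r. \<lbrakk>1 \<le> p; j \<in> {1..p}; r \<in> {1..128}\<rbrakk> \<Longrightarrow>
      (\<integral>\<^sup>+x. ennreal (\<bar>x j\<bar> ^ r) \<partial>P p) < ennreal U \<and> (\<integral>\<^sup>+x. ennreal (\<bar>x j\<bar> ^ r) \<partial>Q p) < ennreal U"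
    using D2 unfolding cond_D2_def by blast
  obtain L U' where L: "0 < L" "0 < U'" and D3': "\<forall>p\<ge>1.
        let S = {mean_sq_dist p (P p) (P p), mean_sq_dist p (P p) (Q p), mean_sq_dist p (Q p) (Q p)}
        in L * real p \<le> Min S \<and> Max S \<le> U' * real p"
    using D3 unfolding cond_D3_def by blast
  have LU: "L * real p \<le> mean_sq_dist p (P p) (P p)" "L * real p \<le> mean_sq_dist p (P p) (Q p)"
    "L * real p \<le> mean_sq_dist p (Q p) (Q p)" "mean_sq_dist p (P p) (P p) \<le> U' * real p"
    "mean_sq_dist p (P p) (Q p) \<le> U' * real p" "mean_sq_dist p (Q p) (Q p) \<le> U' * real p" if "1 \<le> p" for p
    using D3'[rule_format, OF that] by (simp_all add: Let_def)
  obtain c where c: "eventually (\<lambda>p. norm (real (\<alpha> p)) \<le> c * norm (1::real)) at_top"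
    using alpha_bounded by (auto elim: landau_o.bigE)
  have law: "short_range_law p (\<alpha> p) U (P p)" "short_range_law p (\<alpha> p) U (Q p)" if "1 \<le> p" for p
    using laws[OF that] D1 that U[OF that, of _ 4] by (auto simp: short_range_law_def cond_D1_def)
  have PQ: "P p \<noteq> Q p" if "1 \<le> p" for p
  proof
    assume "P p = Q p"
    moreover have "mean_diff_norm p (P p) (P p) = 0" by (simp add: mean_diff_norm_def vdist_def L2_set_def)
    ultimately have "L\<^sub>1 * real p \<le> 0"
      using moment_gap(3)[OF that, unfolded Let_def] by simp
    then show False using moment_gap(1) that by (simp add: mult_le_0_iff)
  qed
  \<comment> \<open>The range of dependence enters as a real argument, to be replaced by its eventual bound \<open>c\<close>.\<close>
  define \<epsilon> where "\<epsilon> = (\<lambda>p a. B * sqrt (16 * U * (2 * a + 1) / L) / sqrt (L * real p))"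
  define \<gamma> where "\<gamma> = 2 * (1 + B)\<^sup>2 + 2 * B\<^sup>2 * U' / L"
  define lb where "lb = (\<lambda>l. 1 - 16 * \<epsilon> (d l) c / L_star - 1600 * \<gamma> * C\<^sup>2 * c_nm (n l) (m l) / L_star\<^sup>2)"
  let ?pr = "\<lambda>l. measure (\<Omega> (d l)) {\<omega> \<in> space (\<Omega> (d l)).
            C < T_stat (k (d l)) (f k (d l) 0 0) (n l) (m l) (\<lambda>i. X (d l) i \<omega>) (\<lambda>j. Y (d l) j \<omega>)}"
  have \<epsilon>_lim: "(\<lambda>l. \<epsilon> (d l) c) \<longlonglongrightarrow> 0"
  proof -
    have "filterlim (\<lambda>l. real (d l)) at_top sequentially"
      by (rule filterlim_compose[OF filterlim_real_sequentially to_infinity(3)])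
    then have "filterlim (\<lambda>l. L * real (d l)) at_top sequentially"
      by (rule filterlim_tendsto_pos_mult_at_top[OF tendsto_const L(1)])
    then have "filterlim (\<lambda>l. sqrt (L * real (d l))) at_top sequentially"
      by (rule filterlim_compose[OF sqrt_at_top])
    then show ?thesis unfolding \<epsilon>_def
      by (intro tendsto_divide_0[OF tendsto_const] filterlim_at_top_imp_at_infinity)
  qed
  have lb_lim: "lb \<longlonglongrightarrow> 1"
  proof -
    have "lb \<longlonglongrightarrow> 1 - 16 * 0 / L_star - 1600 * \<gamma> * C\<^sup>2 * 0 / L_star\<^sup>2"
      unfolding lb_def using L_star(1)
      by (intro tendsto_intros \<epsilon>_lim tendsto_c_nm to_infinity) auto
    then show ?thesis by simp
  qed
  have ev: "eventually (\<lambda>l. 1 \<le> d l \<and> 2 \<le> n l \<and> 2 \<le> m l \<and> real (\<alpha> (d l)) \<le> c \<and> 4 * \<epsilon> (d l) c < L_star) sequentially"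
  proof (intro eventually_conj)
    show "eventually (\<lambda>l. 1 \<le> d l) sequentially" "eventually (\<lambda>l. 2 \<le> n l) sequentially"
      "eventually (\<lambda>l. 2 \<le> m l) sequentially"
      using to_infinity by (auto simp: filterlim_at_top)
    show "eventually (\<lambda>l. real (\<alpha> (d l)) \<le> c) sequentially"
      using eventually_compose_filterlim[OF c to_infinity(3)] by simp
    have "(\<lambda>l. 4 * \<epsilon> (d l) c) \<longlonglongrightarrow> 4 * 0" by (intro tendsto_intros \<epsilon>_lim)
    then show "eventually (\<lambda>l. 4 * \<epsilon> (d l) c < L_star) sequentially"
      using L_star(1) by (intro order_tendstoD) auto
  qed
  have low: "eventually (\<lambda>l. lb l \<le> ?pr l) sequentially"
    using ev
  proof eventually_elim
    case (elim l)
    then have p: "1 \<le> d l" and nm: "2 \<le> n l" "2 \<le> m l" and \<alpha>c: "real (\<alpha> (d l)) \<le> c" and e: "4 * \<epsilon> (d l) c < L_star"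
      by auto
    have U0: "0 \<le> U" by (rule short_range_law_bound_nonneg[OF law(1)[OF p] p])
    have mono: "\<epsilon> (d l) (real (\<alpha> (d l))) \<le> \<epsilon> (d l) c"
      unfolding \<epsilon>_def using \<alpha>c B[OF p] U0 L p
      by (intro divide_right_mono mult_left_mono real_sqrt_le_mono add_right_mono) auto
    have "1 - 16 * \<epsilon> (d l) (real (\<alpha> (d l))) / L_star - 1600 * \<gamma> * C\<^sup>2 * c_nm (n l) (m l) / L_star\<^sup>2 \<le> ?pr l"
      unfolding \<epsilon>_def \<gamma>_def
    proof (rule T_stat_prob_lower_bound[OF p law[OF p] samples[OF p] kernels[OF k p] radial[OF k p]
          derivs[OF k p] _ _ K2'[OF p] B[OF p] L(1) LU[OF p] PQ[OF p] L_star(1) L_star(2)[OF p] C nm])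
      show "{0..} \<subseteq> D k (d l)" using domain[OF k p] by simp
      show "A0 (d l) (P (d l)) (Q (d l)) \<in> D0 k (d l)" using D0[OF k p] by simp
      show "4 * (B * sqrt (16 * U * (2 * real (\<alpha> (d l)) + 1) / L) / sqrt (L * real (d l))) < L_star"
        using e mono by (simp add: \<epsilon>_def)
    qed
    moreover have "16 * \<epsilon> (d l) (real (\<alpha> (d l))) / L_star \<le> 16 * \<epsilon> (d l) c / L_star"
      using mono L_star(1) by (intro divide_right_mono) auto
    ultimately show ?case unfolding lb_def by linarith
  qed
  have up: "eventually (\<lambda>l. ?pr l \<le> 1) sequentially"
    using ev
  proof eventually_elim
    case (elim l)
    then have "prob_space (\<Omega> (d l))" using samples[of "d l"] by (simp add: two_samples_def)
    then show ?case by (rule prob_space.prob_le_1)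
  qed
  show ?thesis
    by (rule tendsto_sandwich[OF low up lb_lim tendsto_const])
qed

end
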